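(* Let $\alpha,\beta,\kappa,\theta$ be generic, let $m,n\ge1$ and let $\lambda',\lambda$ be Young diagrams with $f=m-|\lambda'|=n-|\lambda|\ge0$. In the seminormal representation of $\mathrm{qwB}_{m,n}(\alpha,\beta,\kappa,\theta)$ on the span of the standard triples $\mathcal{T}_{m,n}(\lambda',\lambda)$ (described in the context), the Jucys–Murphy elements $J^{(n)}_2,\dots,J^{(n)}_{m+n}$ act diagonally on the basis of standard triples: for every standard triple $\tau=(B,S,W)$, $$J^{(n)}_j\,\tau=\mathrm{Wt}(\tau)_{j-1}\,\tau,\qquad j=2,\dots,m+n.$$
   Context: $\mathrm{qwB}_{m,n}(\alpha,\beta,\kappa,\theta)$ is the algebra generated by $g_1,\dots,g_{m-1}$, $h_1,\dots,h_{n-1}$, $E$ with relations: $g_j^2=(\alpha+\beta)g_j-\alpha\beta$, $h_i^2=(\alpha+\beta)h_i-\alpha\beta$; type-$A$ braid relations among the $g$'s and among the $h$'s; $g_jh_i=h_ig_j$; $E^2=\frac{\theta+1}{\kappa(\alpha+\beta)}E$; $Eg_1E=\kappa^{-1}E=Eh_1E$; $E$ commutes with $g_j$ ($j\ge2$) and $h_i$ ($i\ge2$); $Eg_1h_1^{-1}E(g_1-h_1)=0=(g_1-h_1)Eg_1h_1^{-1}E$. Jucys–Murphy elements: $J^{(n)}_1=1$, $J^{(n)}_i=(-\alpha\beta)^{-1}h_{n+1-i}J^{(n)}_{i-1}h_{n+1-i}$ for $2\le i\le n$; $J^{(n)}_{n+1}=1-(\alpha+\beta)\kappa\sum_{i=1}^{n}(-\alpha\beta)^{i-1}(h_{i-1}^{-1}h_{i-2}^{-1}\cdots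 h_1^{-1})\,E\,(h_1^{-1}h_2^{-1}\cdots h_{i-1}^{-1})$ (empty products equal $1$); $J^{(n)}_{n+j}=(-\alpha\beta)^{-1}g_{j-1}J^{(n)}_{n+j-1}g_{j-1}$ for $2\le j\le m$. Conventions: box in row $i$, column $j$ has position $(i,j)$, $\mathrm{HD}((i,j))=i-j$, $\mathrm{HD}(p_1,p_2)=\mathrm{HD}(p_1)-\mathrm{HD}(p_2)$, $q=-\beta/\alpha$. A standard triple $(B,S,W)$: $W$ standard with entries $1,\dots,n$ on a diagram $\tilde\lambda\supseteq\lambda$, $|\tilde\lambda/\lambda|=f$; $B$ a standard tableau on $\lambda'$ and $S$ an antistandard filling (strictly decreasing along rows and columns) of $\tilde\lambda/\lambda$, jointly using each of $1'<\dots<m'$ once. Weight $\mathrm{Wt}(B,S,W)=\mu\in\mathbb{C}^{m+n-1}$: $\mu_i=q^{\mathrm{HD}(\mathrm{pos}_W(i+1))}$ ($1\le i\le n-1$); $\mu_{n-1+i}=q^{\mathrm{HD}(\mathrm{pos}_B(i'))}$ if $i'\in B$, $\mu_{n-1+i}=-\theta q^{-\mathrm{HD}(\mathrm{pos}_S(i'))}$ if $i'\in S$. Seminormal action (with $F(x)=\frac{(1+x\beta/\alpha)(1+x\alpha/\beta)}{(1-x)^2}$ and functions $\eta,\zeta$ satisfying $\eta(x)\eta(1/x)=\zeta(x)\zeta(1/x)=-\alpha\beta F(x)$ and $\frac{\eta(x)\zeta(x)\eta(y)\zeta(y)}{\eta(xy)\zeta(xy)}=-\alpha\beta\frac{F(x)F(y)}{F(xy)}$):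 $h_{n-i}(B,S,W)$ is $\alpha(B,S,W)$ or $\beta(B,S,W)$ if $i,i+1$ lie in the same row or column of $W$, else $\frac{\alpha+\beta}{1-\mu_{i-1}/\mu_i}(B,S,W)+\eta(\mu_{i-1}/\mu_i)(B,S,W_{(i,i+1)})$; $g_j(B,S,W)$ is $\alpha(B,S,W)$ or $\beta(B,S,W)$ if $j',(j+1)'$ lie in the same row or column of $B$ or of $S$, else $\frac{\alpha+\beta}{1-\mu_{n+j-1}/\mu_{n+j}}(B,S,W)+\zeta(\mu_{n+j-1}/\mu_{n+j})((B,S)_{(j,j+1)},W)$; $E(B,S,W)=0$ unless $1'\in S$ and the box $b_0$ of $S$ holding $1'$ holds $n$ in $W$, in which case, with $\nu=\tilde\lambda\setminus b_0$ and $(S_b,W_b)$ obtained by moving that box to an addable box $b$ of $\nu$, $E(B,S,W)=\frac{1+\theta q^{-\mathrm{HD}(b_0)}}{\kappa(\alpha+\beta)}\sum_{b}\frac{\prod_{\delta\in\mathrm{Corners}(\nu)}(1-q^{\mathrm{HD}(\delta,b)})}{\prod_{b'\ne b}(1-q^{\mathrm{HD}(b',b)})}(B,S_b,W_b)$, sums/products over addable boxes $b,b'$ of $\nu$ and corners (removable boxes) $\delta$ of $\nu$. *)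

theory Defs
  imports Complex_Main
begin

record qwb_param =
  alp :: complex
  bet :: complex
  kap :: complex
  tht :: complex
  eta :: "complex \<Rightarrow> complex"
  zeta :: "complex \<Rightarrow> complex"

definition qpar :: "qwb_param \<Rightarrow> complex" where
  "qpar P = - bet P / alp P"

definition Ffun :: "qwb_param \<Rightarrow> complex \<Rightarrow> complex" where
  "Ffun P x = (1 + x * bet P / alp P) * (1 + x * alp P / bet P) / (1 - x)^2"

definition generic_params :: "qwb_param \<Rightarrow> bool" where
  "generic_params P \<longleftrightarrow> alp P \<noteq> 0 \<and> bet P \<noteq> 0 \<and> kap P \<noteq> 0 \<and> tht P \<noteq> 0
     \<and> alp P + bet P \<noteq> 0
     \<and> (\<forall>k::int. k \<noteq> 0 \<longrightarrow> qpar P powi k \<noteq> 1)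
     \<and> (\<forall>k::int. tht P \<noteq> qpar P powi k \<and> tht P \<noteq> - (qpar P powi k))"

text \<open>The functional equations for eta and zeta (imposed wherever both sides are defined).\<close>
definition eta_zeta_ok :: "qwb_param \<Rightarrow> bool" where
  "eta_zeta_ok P \<longleftrightarrow>
     (\<forall>x. x \<noteq> 0 \<and> x \<noteq> 1 \<longrightarrow>
        eta P x * eta P (1/x) = - alp P * bet P * Ffun P x
      \<and> zeta P x * zeta P (1/x) = - alp P * bet P * Ffun P x)
   \<and> (\<forall>x y. x \<notin> {0,1} \<and> y \<notin> {0,1} \<and> x*y \<notin> {0,1} \<and> Ffun P (x*y) \<noteq> 0
        \<and> eta P (x*y) * zeta P (x*y) \<noteq> 0 \<longrightarrow>
        eta P x * zeta P x * eta P y * zeta P y / (eta P (x*y) * zeta P (x*y))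
        = - alp P * bet P * Ffun P x * Ffun P y / Ffun P (x*y))"

type_synonym box = "nat \<times> nat"   (* (row, column), 1-indexed *)
type_synonym tab = "box \<Rightarrow> nat"   (* filling; 0 outside its shape *)
type_synonym triple = "tab \<times> tab \<times> tab"
type_synonym vec = "triple \<Rightarrow> complex"
type_synonym op = "vec \<Rightarrow> vec"

definition young :: "box set \<Rightarrow> bool" where
  "young D \<longleftrightarrow> finite D \<and> (\<forall>(i,j)\<in>D. 1 \<le> i \<and> 1 \<le> j \<and>
      (\<forall>i' j'. 1 \<le> i' \<and> i' \<le> i \<and> 1 \<le> j' \<and> j' \<le> j \<longrightarrow> (i',j') \<in> D))"

definition HD :: "box \<Rightarrow> int" where
  "HD b = int (fst b) - int (snd b)"

definition shape :: "tab \<Rightarrow> box set" where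
  "shape T = {b. T b \<noteq> 0}"

definition pos :: "tab \<Rightarrow> nat \<Rightarrow> box" where
  "pos T k = (THE b. T b = k)"

definition vals :: "tab \<Rightarrow> nat set" where
  "vals T = T ` shape T"

definition rc_incr :: "tab \<Rightarrow> box set \<Rightarrow> bool" where
  "rc_incr T D \<longleftrightarrow> (\<forall>(i,j)\<in>D. \<forall>(i',j')\<in>D.
      (i = i' \<and> j < j') \<or> (j = j' \<and> i < i') \<longrightarrow> T (i,j) < T (i',j'))"

definition rc_decr :: "tab \<Rightarrow> box set \<Rightarrow> bool" where
  "rc_decr T D \<longleftrightarrow> (\<forall>(i,j)\<in>D. \<forall>(i',j')\<in>D.
      (i = i' \<and> j < j') \<or> (j = j' \<and> i < i') \<longrightarrow> T (i,j) > T (i',j'))"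

text \<open>Standard triples (B,S,W); the labels j' are encoded as the natural numbers j;
  the diagram lambda-tilde is the shape of W.\<close>
definition std_triple :: "nat \<Rightarrow> nat \<Rightarrow> box set \<Rightarrow> box set \<Rightarrow> triple \<Rightarrow> bool" where
  "std_triple m n lam' lam \<tau> \<longleftrightarrow> (case \<tau> of (B, S, W) \<Rightarrow>
     young (shape W) \<and> lam \<subseteq> shape W \<and> card (shape W - lam) = m - card lam'
     \<and> bij_betw W (shape W) {1..n} \<and> rc_incr W (shape W)
     \<and> shape B = lam' \<and> inj_on B lam' \<and> rc_incr B lam'
     \<and> shape S = shape W - lam \<and> inj_on S (shape S) \<and> rc_decr S (shape S)
     \<and> vals B \<inter> vals S = {} \<and> vals B \<union> vals S = {1..m})"

definition Tset :: "nat \<Rightarrow> nat \<Rightarrow> box set \<Rightarrow> box set \<Rightarrow> triple set" where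
  "Tset m n lam' lam = {\<tau>. std_triple m n lam' lam \<tau>}"

text \<open>Weight. Index k = 1..m+n-1 is Wt(tau)_k of the paper; index 0 is the convention
  mu_0 = q^HD(pos_W 1) = 1 used in the formula for h_{n-1}.\<close>
definition Wt :: "qwb_param \<Rightarrow> nat \<Rightarrow> triple \<Rightarrow> nat \<Rightarrow> complex" where
  "Wt P n \<tau> k = (case \<tau> of (B, S, W) \<Rightarrow>
     if k < n then qpar P powi HD (pos W (k+1))
     else (let i = k + 1 - n in
       if i \<in> vals B then qpar P powi HD (pos B i)
       else - tht P * qpar P powi (- HD (pos S i))))"

definition delta :: "triple \<Rightarrow> vec" where
  "delta \<tau> = (\<lambda>\<sigma>. if \<sigma> = \<tau> then 1 else 0)"

definition swapv :: "nat \<Rightarrow> nat \<Rightarrow> tab \<Rightarrow> tab" where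
  "swapv a b T = (\<lambda>x. if T x = a then b else if T x = b then a else T x)"

definition addable :: "box set \<Rightarrow> box set" where
  "addable D = {b. b \<notin> D \<and> young (insert b D)}"

definition corners :: "box set \<Rightarrow> box set" where
  "corners D = {b \<in> D. young (D - {b})}"

definition h_basis :: "qwb_param \<Rightarrow> nat \<Rightarrow> nat \<Rightarrow> triple \<Rightarrow> vec" where
  "h_basis P n i \<tau> = (case \<tau> of (B, S, W) \<Rightarrow>
     let k = n - i; p = pos W k; p' = pos W (k+1) in
     if fst p = fst p' then (\<lambda>\<sigma>. alp P * delta \<tau> \<sigma>)
     else if snd p = snd p' then (\<lambda>\<sigma>. bet P * delta \<tau> \<sigma>)
     else (let x = Wt P n \<tau> (k - 1) / Wt P n \<tau> k in
       (\<lambda>\<sigma>. (alp P + bet P) / (1 - x) * delta \<tau> \<sigma>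
             + eta P x * delta (B, S, swapv k (k+1) W) \<sigma>)))"

definition g_basis :: "qwb_param \<Rightarrow> nat \<Rightarrow> nat \<Rightarrow> triple \<Rightarrow> vec" where
  "g_basis P n j \<tau> = (case \<tau> of (B, S, W) \<Rightarrow>
     let inB = (j \<in> vals B \<and> j+1 \<in> vals B);
         inS = (j \<in> vals S \<and> j+1 \<in> vals S);
         T = (if inB then B else S); p = pos T j; p' = pos T (j+1) in
     if (inB \<or> inS) \<and> fst p = fst p' then (\<lambda>\<sigma>. alp P * delta \<tau> \<sigma>)
     else if (inB \<or> inS) \<and> snd p = snd p' then (\<lambda>\<sigma>. bet P * delta \<tau> \<sigma>)
     else (let x = Wt P n \<tau> (n + j - 1) / Wt P n \<tau> (n + j) in
       (\<lambda>\<sigma>. (alp P + bet P) / (1 - x) * delta \<tau> \<sigma>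
             + zeta P x * delta (swapv j (j+1) B, swapv j (j+1) S, W) \<sigma>)))"

definition E_basis :: "qwb_param \<Rightarrow> nat \<Rightarrow> triple \<Rightarrow> vec" where
  "E_basis P n \<tau> = (case \<tau> of (B, S, W) \<Rightarrow>
     if 1 \<in> vals S \<and> W (pos S 1) = n then
       (let b0 = pos S 1; \<nu> = shape W - {b0};
            c0 = (1 + tht P * qpar P powi (- HD b0)) / (kap P * (alp P + bet P)) in
        (\<lambda>\<sigma>. \<Sum>b\<in>addable \<nu>.
            c0 * (\<Prod>d\<in>corners \<nu>. (1 - qpar P powi (HD d - HD b)))
               / (\<Prod>b'\<in>addable \<nu> - {b}. (1 - qpar P powi (HD b' - HD b)))
               * delta (B, S(b0 := 0, b := 1), W(b0 := 0, b := n)) \<sigma>))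
     else (\<lambda>\<sigma>. 0))"

definition lin :: "triple set \<Rightarrow> (triple \<Rightarrow> vec) \<Rightarrow> op" where
  "lin T X v = (\<lambda>\<sigma>. \<Sum>\<tau>\<in>T. v \<tau> * X \<tau> \<sigma>)"

definition h_op :: "qwb_param \<Rightarrow> nat \<Rightarrow> nat \<Rightarrow> box set \<Rightarrow> box set \<Rightarrow> nat \<Rightarrow> op" where
  "h_op P m n lam' lam i = lin (Tset m n lam' lam) (h_basis P n i)"

definition g_op :: "qwb_param \<Rightarrow> nat \<Rightarrow> nat \<Rightarrow> box set \<Rightarrow> box set \<Rightarrow> nat \<Rightarrow> op" where
  "g_op P m n lam' lam j = lin (Tset m n lam' lam) (g_basis P n j)"

definition E_op :: "qwb_param \<Rightarrow> nat \<Rightarrow> nat \<Rightarrow> box set \<Rightarrow> box set \<Rightarrow> op" where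
  "E_op P m n lam' lam = lin (Tset m n lam' lam) (E_basis P n)"

text \<open>h_i^{-1} = ((alpha+beta) - h_i)/(alpha beta), from the quadratic relation.\<close>
definition hinv_op :: "qwb_param \<Rightarrow> nat \<Rightarrow> nat \<Rightarrow> box set \<Rightarrow> box set \<Rightarrow> nat \<Rightarrow> op" where
  "hinv_op P m n lam' lam i = (\<lambda>v \<sigma>.
     ((alp P + bet P) * v \<sigma> - h_op P m n lam' lam i v \<sigma>) / (alp P * bet P))"

primrec Lh :: "qwb_param \<Rightarrow> nat \<Rightarrow> nat \<Rightarrow> box set \<Rightarrow> box set \<Rightarrow> nat \<Rightarrow> op" where
  "Lh P m n lam' lam 0 = id"
| "Lh P m n lam' lam (Suc k) = hinv_op P m n lam' lam (Suc k) \<circ> Lh P m n lam' lam k"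

primrec Rh :: "qwb_param \<Rightarrow> nat \<Rightarrow> nat \<Rightarrow> box set \<Rightarrow> box set \<Rightarrow> nat \<Rightarrow> op" where
  "Rh P m n lam' lam 0 = id"
| "Rh P m n lam' lam (Suc k) = Rh P m n lam' lam k \<circ> hinv_op P m n lam' lam (Suc k)"

definition J_np1 :: "qwb_param \<Rightarrow> nat \<Rightarrow> nat \<Rightarrow> box set \<Rightarrow> box set \<Rightarrow> op" where
  "J_np1 P m n lam' lam = (\<lambda>v \<sigma>. v \<sigma> - (alp P + bet P) * kap P *
     (\<Sum>i = 1..n. (- (alp P * bet P)) ^ (i - 1) *
        Lh P m n lam' lam (i - 1) (E_op P m n lam' lam (Rh P m n lam' lam (i - 1) v)) \<sigma>))"

text \<open>Action of the Jucys--Murphy element J^{(n)}_i (index i >= 1).\<close>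
primrec JM :: "qwb_param \<Rightarrow> nat \<Rightarrow> nat \<Rightarrow> box set \<Rightarrow> box set \<Rightarrow> nat \<Rightarrow> op" where
  "JM P m n lam' lam 0 = id"
| "JM P m n lam' lam (Suc k) =
     (if Suc k = 1 then id
      else if Suc k \<le> n then
        (\<lambda>v \<sigma>. h_op P m n lam' lam (n - k) (JM P m n lam' lam k (h_op P m n lam' lam (n - k) v)) \<sigma>
                / (- (alp P * bet P)))
      else if Suc k = n + 1 then J_np1 P m n lam' lam
      else
        (\<lambda>v \<sigma>. g_op P m n lam' lam (k - n) (JM P m n lam' lam k (g_op P m n lam' lam (k - n) v)) \<sigma>
                / (- (alp P * bet P))))"

end

theory Submission
  imports Defs "HOL-Library.Multiset" "HOL-Library.Product_Order" "HOL-Combinatorics.Transposition"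
    "HOL-Computational_Algebra.Polynomial"
begin

text \<open>
  For \<open>j \<noteq> n + 1\<close> the generator conjugating the previous Jucys--Murphy element acts by a scalar or
  by a \<open>2 \<times> 2\<close> block, and the eigenvalue follows from the functional equations of \<open>\<eta>\<close> and \<open>\<zeta>\<close>.

  For \<open>j = n + 1\<close> only the case \<open>1' \<in> S\<close> is interesting.  Let \<open>\<nu>\<close> be the shape of \<open>W\<close> without the box
  of \<open>1'\<close>.  The tableaux on the diagrams \<open>\<nu> + b\<close>, \<open>b\<close> addable, span the module of the Hecke
  algebra \<open>H\<^sub>n\<close> induced from the Specht module of \<open>\<nu>\<close>, and \<open>E\<close> is a combination of the operators
  \<open>P\<^sub>b\<^sub>c\<close> that move the box of \<open>n\<close> from \<open>b\<close> to \<open>c\<close>.  The claim reduces to: the relative trace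
  \<open>\<Sum>\<^sub>i (- \<alpha> \<beta>)\<^sup>i\<^sup>-\<^sup>1 h\<^sub>i\<^sub>-\<^sub>1\<^sup>-\<^sup>1 \<cdots> h\<^sub>1\<^sup>-\<^sup>1 P\<^sub>b\<^sub>c h\<^sub>1\<^sup>-\<^sup>1 \<cdots> h\<^sub>i\<^sub>-\<^sub>1\<^sup>-\<^sup>1\<close> is zero for \<open>b \<noteq> c\<close> and, for
  \<open>b = c\<close>, the reciprocal of the product ratio attached to \<open>b\<close> in \<open>E\<close>.  This is shown by
  induction on \<open>n\<close> without using the braid relations: \<open>h\<^sub>1\<^sup>-\<^sup>1 P\<^sub>b\<^sub>c h\<^sub>1\<^sup>-\<^sup>1\<close> is a combination of
  operators of the same kind one level below, and the scalars match by a partial fraction expansion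
  over the corners of \<open>\<nu>\<close>.
\<close>

section \<open>Young diagrams as lower sets\<close>

lemma young_iff:
  "young D \<longleftrightarrow> finite D \<and> (\<forall>x\<in>D. (1, 1) \<le> x) \<and> (\<forall>x\<in>D. \<forall>y. (1, 1) \<le> y \<longrightarrow> y \<le> x \<longrightarrow> y \<in> D)"
proof -
  have "(\<forall>i' j'. 1 \<le> i' \<and> i' \<le> i \<and> 1 \<le> j' \<and> j' \<le> j \<longrightarrow> (i', j') \<in> D)
      \<longleftrightarrow> (\<forall>y. (1, 1) \<le> y \<longrightarrow> y \<le> (i, j) \<longrightarrow> y \<in> D)" for i j
    by auto
  then show ?thesis
    unfolding young_def by (fastforce simp: split_beta less_eq_prod_def)
qed

lemma young_finite: "young D \<Longrightarrow> finite D"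
  by (simp add: young_def)

lemma young_ge_1: "young D \<Longrightarrow> x \<in> D \<Longrightarrow> (1, 1) \<le> x"
  unfolding young_iff by blast

lemma young_downward: "young D \<Longrightarrow> x \<in> D \<Longrightarrow> (1, 1) \<le> y \<Longrightarrow> y \<le> x \<Longrightarrow> y \<in> D"
  unfolding young_iff by blast

lemma young_empty: "young {}"
  by (simp add: young_def)

lemma addable_iff_minimal:
  assumes "young D"
  shows "b \<in> addable D \<longleftrightarrow> b \<notin> D \<and> (1, 1) \<le> b \<and> (\<forall>x. (1, 1) \<le> x \<longrightarrow> x < b \<longrightarrow> x \<in> D)"
  using assms unfolding addable_def mem_Collect_eq young_iff insert_iff
  by (auto simp: order_le_less)

lemma corners_iff_maximal:
  assumes "young D"
  shows "b \<in> corners D \<longleftrightarrow> b \<in> D \<and> (\<forall>x. b < x \<longrightarrow> x \<notin> D)"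
proof
  assume "b \<in> corners D"
  then have "b \<in> D" "young (D - {b})" by (auto simp: corners_def)
  moreover from this have "x \<notin> D" if "b < x" for x
    using young_downward[of "D - {b}" x b] young_ge_1[OF assms] that
    by (metis Diff_iff insertI1 order_less_imp_le order_less_irrefl singletonD)
  ultimately show "b \<in> D \<and> (\<forall>x. b < x \<longrightarrow> x \<notin> D)" by blast
next
  assume "b \<in> D \<and> (\<forall>x. b < x \<longrightarrow> x \<notin> D)"
  then have "young (D - {b})"
    using assms unfolding young_iff by (metis Diff_iff finite_Diff order_le_less singletonD)
  then show "b \<in> corners D" using \<open>b \<in> D \<and> _\<close> by (simp add: corners_def)
qed

lemma box_less_iff: "(i, j) < x \<longleftrightarrow> (i + 1, j) \<le> x \<or> (i, j + 1) \<le> x" for x :: box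
  by (cases x) (auto simp: less_prod_def)

lemma addable_iff:
  assumes "young D"
  shows "(i, j) \<in> addable D \<longleftrightarrow> (i, j) \<notin> D \<and> 1 \<le> i \<and> 1 \<le> j
    \<and> (i = 1 \<or> (i - 1, j) \<in> D) \<and> (j = 1 \<or> (i, j - 1) \<in> D)"
proof -
  have "(\<forall>x. (1, 1) \<le> x \<longrightarrow> x < (i, j) \<longrightarrow> x \<in> D) \<longleftrightarrow>
      (i = 1 \<or> (i - 1, j) \<in> D) \<and> (j = 1 \<or> (i, j - 1) \<in> D)" if "1 \<le> i" "1 \<le> j"
  proof (intro iffI conjI allI impI)
    assume "\<forall>x. (1, 1) \<le> x \<longrightarrow> x < (i, j) \<longrightarrow> x \<in> D"
    then have smaller: "(k, l) \<in> D" if "1 \<le> k" "1 \<le> l" "(k, l) < (i, j)" for k l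
      using that by simp
    show "i = 1 \<or> (i - 1, j) \<in> D"
      using smaller[of "i - 1" j] that by (cases "i \<le> 1") (auto simp: less_prod_def)
    show "j = 1 \<or> (i, j - 1) \<in> D"
      using smaller[of i "j - 1"] that by (cases "j \<le> 1") (auto simp: less_prod_def)
  next
    fix x :: box
    assume neighbours: "(i = 1 \<or> (i - 1, j) \<in> D) \<and> (j = 1 \<or> (i, j - 1) \<in> D)"
      and x: "(1, 1) \<le> x" "x < (i, j)"
    have "x \<le> (i - 1, j) \<and> i \<noteq> 1 \<or> x \<le> (i, j - 1) \<and> j \<noteq> 1"
      using x that by (cases x) (auto simp: less_prod_def)
    then show "x \<in> D" using neighbours x(1) young_downward[OF assms] by blast
  qed
  then show ?thesis unfolding addable_iff_minimal[OF assms] by auto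
qed

lemma corners_iff:
  assumes "young D"
  shows "(i, j) \<in> corners D \<longleftrightarrow> (i, j) \<in> D \<and> (i + 1, j) \<notin> D \<and> (i, j + 1) \<notin> D"
proof -
  have "(\<forall>x. (i, j) < x \<longrightarrow> x \<notin> D) \<longleftrightarrow> (i + 1, j) \<notin> D \<and> (i, j + 1) \<notin> D" if "(i, j) \<in> D"
  proof -
    have "(1, 1) \<le> (i + 1, j)" "(1, 1) \<le> (i, j + 1)" using young_ge_1[OF assms that] by auto
    then show ?thesis unfolding box_less_iff using young_downward[OF assms] by blast
  qed
  then show ?thesis unfolding corners_iff_maximal[OF assms] by blast
qed

lemma young_insert_addable: "b \<in> addable D \<Longrightarrow> young (insert b D)"
  by (simp add: addable_def)

lemma addable_notin: "b \<in> addable D \<Longrightarrow> b \<notin> D"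
  by (simp add: addable_def)

lemma addable_ge_1: "b \<in> addable D \<Longrightarrow> (1, 1) \<le> b"
  using young_insert_addable young_ge_1 by blast

lemma addable_not_below: "young D \<Longrightarrow> b \<in> addable D \<Longrightarrow> x \<in> D \<Longrightarrow> \<not> b \<le> x"
  using addable_notin addable_ge_1 young_downward by blast

lemma young_remove_corner: "b \<in> corners D \<Longrightarrow> young (D - {b})"
  by (simp add: corners_def)

lemma corner_in: "b \<in> corners D \<Longrightarrow> b \<in> D"
  by (simp add: corners_def)

lemma addable_remove_corner: "young D \<Longrightarrow> b \<in> corners D \<Longrightarrow> b \<in> addable (D - {b})"
  by (auto simp: corners_def addable_def insert_absorb)

lemma corner_insert_addable: "young D \<Longrightarrow> b \<in> addable D \<Longrightarrow> b \<in> corners (insert b D)"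
  by (auto simp: corners_def addable_def)

lemma finite_corners: "young D \<Longrightarrow> finite (corners D)"
  by (simp add: corners_def young_finite)

lemma addable_empty: "addable {} = {(1, 1)}"
proof (rule set_eqI)
  fix b :: box
  have "(1, 1) \<le> b \<and> (\<forall>x. (1, 1) \<le> x \<longrightarrow> \<not> x < b) \<longleftrightarrow> b = (1, 1)"
    by (metis leD order_le_less order_refl)
  then show "b \<in> addable {} \<longleftrightarrow> b \<in> {(1, 1)}"
    unfolding addable_iff_minimal[OF young_empty] by blast
qed

lemma corners_empty: "corners {} = {}"
  by (simp add: corners_def)

lemma young_induct [consumes 1, case_names empty insert]:
  assumes "young D" "P {}"
    and insert: "\<And>b D. young D \<Longrightarrow> b \<in> addable D \<Longrightarrow> P D \<Longrightarrow> P (insert b D)"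
  shows "P D"
  using young_finite[OF assms(1)] assms(1)
proof (induction D rule: finite_psubset_induct)
  case (psubset D)
  show ?case
  proof (cases "D = {}")
    case False
    then obtain b where "b \<in> D" "\<forall>x\<in>D. b \<le> x \<longrightarrow> b = x"
      using finite_has_maximal[OF psubset.hyps] by metis
    then have corner: "b \<in> corners D"
      by (auto simp: corners_iff_maximal[OF psubset.prems] dest: less_imp_le)
    have "P (D - {b})"
      using psubset.IH[of "D - {b}"] corner_in[OF corner] young_remove_corner[OF corner] by blast
    then have "P (insert b (D - {b}))"
      using insert young_remove_corner[OF corner] addable_remove_corner[OF psubset.prems corner]
      by blast
    then show ?thesis using corner_in[OF corner] by (simp add: insert_absorb)
  qed (use assms(2) in simp)
qed

section \<open>Alignment and contents\<close>

definition aligned :: "box \<Rightarrow> box \<Rightarrow> bool" where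
  "aligned b c \<longleftrightarrow> fst b = fst c \<or> snd b = snd c"

lemma aligned_commute: "aligned b c \<longleftrightarrow> aligned c b"
  by (auto simp: aligned_def)

definition covers :: "box \<Rightarrow> box \<Rightarrow> bool" where
  "covers c b \<longleftrightarrow> c = (fst b + 1, snd b) \<or> c = (fst b, snd b + 1)"

lemma coversI:
  assumes "b < c" "\<And>x. b < x \<Longrightarrow> x < c \<Longrightarrow> False"
  shows "covers c b"
proof -
  obtain i j k l where coords: "b = (i, j)" "c = (k, l)" by (metis surj_pair)
  have "i < k \<and> j \<le> l \<or> i \<le> k \<and> j < l" using assms(1) by (auto simp: coords less_prod_def)
  then have "(i + 1, j) \<le> c \<or> (i, j + 1) \<le> c" by (auto simp: coords)
  moreover have "b < (i + 1, j)" "b < (i, j + 1)" by (auto simp: coords less_prod_def)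
  ultimately have "(i + 1, j) = c \<or> (i, j + 1) = c" using assms(2) order_le_less by blast
  then show ?thesis by (auto simp: covers_def coords)
qed

lemma covers_aligned: "covers c b \<Longrightarrow> aligned b c"
  by (auto simp: covers_def aligned_def)

lemma HD_covers:
  assumes "covers c b"
  shows "HD c \<noteq> HD b" "fst b = fst c \<Longrightarrow> HD c = HD b - 1" "snd b = snd c \<Longrightarrow> HD c = HD b + 1"
  using assms unfolding covers_def HD_def by (auto simp: prod_eq_iff)

lemma comparable_if_aligned: "aligned b c \<Longrightarrow> b \<le> c \<or> c \<le> b"
  by (auto simp: aligned_def less_eq_prod_def)

lemma comparable_if_HD_close: "\<bar>HD b - HD c\<bar> \<le> 1 \<Longrightarrow> b \<le> c \<or> c \<le> b"
  by (auto simp: HD_def less_eq_prod_def)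

lemma HD_if_comparable_covers:
  assumes "b \<le> c \<or> c \<le> b \<Longrightarrow> covers c b"
  shows "HD c \<noteq> HD b" "fst b = fst c \<Longrightarrow> HD c = HD b - 1" "snd b = snd c \<Longrightarrow> HD c = HD b + 1"
proof -
  have "covers c b" if "HD c = HD b \<or> aligned b c"
    using that assms comparable_if_HD_close[of b c] comparable_if_aligned[of b c] by auto
  then show "HD c \<noteq> HD b" "fst b = fst c \<Longrightarrow> HD c = HD b - 1" "snd b = snd c \<Longrightarrow> HD c = HD b + 1"
    using HD_covers[of c b] unfolding aligned_def by blast+
qed

lemma comparable_addable_eq:
  assumes "young D" "b \<in> addable D" "c \<in> addable D" "b \<le> c \<or> c \<le> b"
  shows "b = c"
  using assms addable_iff_minimal[OF assms(1)] by (metis order_le_less)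

lemma comparable_corners_eq:
  assumes "young D" "b \<in> corners D" "c \<in> corners D" "b \<le> c \<or> c \<le> b"
  shows "b = c"
  using assms corners_iff_maximal[OF assms(1)] by (metis order_le_less)

lemma comparable_corner_addable_covers:
  assumes "young D" "b \<in> addable D" "d \<in> corners D" "b \<le> d \<or> d \<le> b"
  shows "covers b d"
proof (rule coversI)
  show "d < b"
    using addable_not_below[OF assms(1,2) corner_in[OF assms(3)]] assms(4)
    by (simp add: less_le_not_le)
next
  fix x assume between: "d < x" "x < b"
  have "(1, 1) \<le> x"
    using young_ge_1[OF assms(1) corner_in[OF assms(3)]] between(1)
    by (meson less_imp_le order_trans)
  then show False
    using between assms(2,3)
    unfolding addable_iff_minimal[OF assms(1)] corners_iff_maximal[OF assms(1)] by blast
qed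

lemma inj_on_HD_addable: "young D \<Longrightarrow> inj_on HD (addable D)"
  using comparable_addable_eq comparable_if_HD_close by (auto intro!: inj_onI)

lemma inj_on_HD_corners: "young D \<Longrightarrow> inj_on HD (corners D)"
  using comparable_corners_eq comparable_if_HD_close by (auto intro!: inj_onI)

lemma HD_corner_neq_addable:
  assumes "young D" "b \<in> addable D" "d \<in> corners D"
  shows "HD d \<noteq> HD b"
  using HD_if_comparable_covers(1)[of d b] comparable_corner_addable_covers[OF assms] by force

lemma not_aligned_corners:
  assumes "young D" "b \<in> corners D" "c \<in> corners D" "b \<noteq> c"
  shows "\<not> aligned b c"
  using assms comparable_corners_eq comparable_if_aligned by blast

lemma HD_adjacent_corner_aligned:
  assumes "young D" "b \<in> addable D" "d \<in> corners D" "\<bar>HD b - HD d\<bar> \<le> 1"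
  shows "aligned d b"
  using comparable_corner_addable_covers[OF assms(1-3)] comparable_if_HD_close[OF assms(4)]
    covers_aligned by blast

lemma addable_after_removing_corner:
  assumes "young D" "b \<in> addable D" "d \<in> corners D" "\<not> aligned b d"
  shows "b \<in> addable (D - {d})"
proof -
  have "\<not> d < b"
    using comparable_corner_addable_covers[OF assms(1-3)] covers_aligned assms(4) aligned_commute
      order_less_imp_le by metis
  then show ?thesis
    using assms(2) by (auto simp: addable_iff_minimal[OF assms(1)]
        addable_iff_minimal[OF young_remove_corner[OF assms(3)]])
qed

lemma corners_insert_addableD:
  assumes "young D" "b \<in> addable D" "d \<in> corners (insert b D)" "d \<noteq> b"
  shows "d \<in> corners D" "\<not> aligned b d"
proof -
  note young_insert = young_insert_addable[OF assms(2)]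
  show "d \<in> corners D"
    using assms(3,4)
    unfolding corners_iff_maximal[OF assms(1)] corners_iff_maximal[OF young_insert] by blast
  show "\<not> aligned b d"
    using not_aligned_corners[OF young_insert corner_insert_addable[OF assms(1,2)] assms(3)]
      assms(4) by blast
qed

lemma addable_insert_Diff:
  assumes "young D" "(i, j) \<in> addable D"
  shows "addable (insert (i, j) D) - {(i + 1, j), (i, j + 1)} = addable D - {(i, j)}"
proof -
  have "x \<in> addable (insert (i, j) D) \<and> x \<notin> {(i + 1, j), (i, j + 1)} \<longleftrightarrow>
      x \<in> addable D \<and> x \<noteq> (i, j)" for x
    using assms(2)
    by (cases x) (auto simp: addable_iff[OF assms(1)]
        addable_iff[OF young_insert_addable[OF assms(2)]])
  then show ?thesis by blast
qed

lemma corners_insert_Diff: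
  assumes "young D" "(i, j) \<in> addable D"
  shows "corners (insert (i, j) D) - {(i, j)} = corners D - {(i, j - 1), (i - 1, j)}"
proof -
  have "x \<in> corners (insert (i, j) D) \<and> x \<noteq> (i, j) \<longleftrightarrow>
      x \<in> corners D \<and> x \<notin> {(i, j - 1), (i - 1, j)}" for x
    using assms(2)
    by (cases x) (auto simp: addable_iff[OF assms(1)] corners_iff[OF assms(1)]
        corners_iff[OF young_insert_addable[OF assms(2)]])
  then show ?thesis by blast
qed

lemma addable_beside_iff_not_corner:
  assumes "young D" "(i, j) \<in> addable D"
  shows "(i + 1, j) \<in> addable (insert (i, j) D) \<longleftrightarrow> (i, j - 1) \<notin> corners D"
    and "(i, j + 1) \<in> addable (insert (i, j) D) \<longleftrightarrow> (i - 1, j) \<notin> corners D"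
proof -
  have inside: "(i, j) \<notin> D" "1 \<le> i" "1 \<le> j" "i = 1 \<or> (i - 1, j) \<in> D" "j = 1 \<or> (i, j - 1) \<in> D"
    using assms(2) by (auto simp: addable_iff[OF assms(1)])
  have outside: "(i + 1, j) \<notin> D" "(i, j + 1) \<notin> D" "(0, j) \<notin> D" "(i, 0) \<notin> D"
    using addable_not_below[OF assms] young_ge_1[OF assms(1)] by fastforce+
  have "(i, j - 1) \<in> corners D \<longleftrightarrow> j \<noteq> 1 \<and> (i + 1, j - 1) \<notin> D"
      "(i - 1, j) \<in> corners D \<longleftrightarrow> i \<noteq> 1 \<and> (i - 1, j + 1) \<notin> D"
    using inside outside by (auto simp: corners_iff[OF assms(1)])
  moreover have "(i + 1, j) \<in> addable (insert (i, j) D) \<longleftrightarrow> j = 1 \<or> (i + 1, j - 1) \<in> D"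
      "(i, j + 1) \<in> addable (insert (i, j) D) \<longleftrightarrow> i = 1 \<or> (i - 1, j + 1) \<in> D"
    using inside outside by (simp_all add: addable_iff[OF young_insert_addable[OF assms(2)]])
  ultimately show "(i + 1, j) \<in> addable (insert (i, j) D) \<longleftrightarrow> (i, j - 1) \<notin> corners D"
    and "(i, j + 1) \<in> addable (insert (i, j) D) \<longleftrightarrow> (i - 1, j) \<notin> corners D"
    by blast+
qed

lemma finite_addable:
  assumes "young D"
  shows "finite (addable D)"
  using assms
proof (induction rule: young_induct)
  case (insert b D)
  obtain i j where "b = (i, j)" by force
  then have "addable (insert b D) \<subseteq> addable D \<union> {(i + 1, j), (i, j + 1)}"
    using addable_insert_Diff[of D i j] insert.hyps by blast
  then show ?case using insert.IH by (simp add: finite_subset)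
qed (simp add: addable_empty)

definition addable_contents :: "box set \<Rightarrow> int multiset" where
  "addable_contents D = image_mset HD (mset_set (addable D))"

definition corner_contents :: "box set \<Rightarrow> int multiset" where
  "corner_contents D = image_mset HD (mset_set (corners D))"

lemma addable_contents_insert:
  assumes "young D" "(i, j) \<in> addable D"
  shows "addable_contents (insert (i, j) D) + {#HD (i, j)#} = addable_contents D +
    (if (i, j - 1) \<in> corners D then {#} else {#HD (i, j) + 1#}) +
    (if (i - 1, j) \<in> corners D then {#} else {#HD (i, j) - 1#})"
proof -
  let ?new = "{x \<in> {(i + 1, j), (i, j + 1)}. x \<in> addable (insert (i, j) D)}"
  have "addable (insert (i, j) D) = (addable D - {(i, j)}) \<union> ?new"
      "(addable D - {(i, j)}) \<inter> ?new = {}"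
    unfolding addable_insert_Diff[OF assms, symmetric] by blast+
  then have "mset_set (addable (insert (i, j) D)) = mset_set (addable D - {(i, j)}) + mset_set ?new"
    using finite_addable[OF assms(1)] mset_set_Union[of "addable D - {(i, j)}" ?new] by simp
  moreover have "mset_set ?new = (if (i, j - 1) \<in> corners D then {#} else {#(i + 1, j)#}) +
      (if (i - 1, j) \<in> corners D then {#} else {#(i, j + 1)#})"
    using addable_beside_iff_not_corner[OF assms] by (subst filter_mset_mset_set[symmetric]) auto
  moreover have "mset_set (addable D) = add_mset (i, j) (mset_set (addable D - {(i, j)}))"
    using mset_set.remove[OF finite_addable[OF assms(1)] assms(2)] .
  moreover have "HD (i + 1, j) = HD (i, j) + 1" "HD (i, j + 1) = HD (i, j) - 1"
    by (simp_all add: HD_def)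
  ultimately show ?thesis
    by (simp add: addable_contents_def add_mset_commute)
qed

lemma corner_contents_insert:
  assumes "young D" "(i, j) \<in> addable D"
  shows "corner_contents D + {#HD (i, j)#} = corner_contents (insert (i, j) D) +
    (if (i, j - 1) \<in> corners D then {#HD (i, j) + 1#} else {#}) +
    (if (i - 1, j) \<in> corners D then {#HD (i, j) - 1#} else {#})"
proof -
  let ?old = "{x \<in> {(i, j - 1), (i - 1, j)}. x \<in> corners D}"
  have ij: "1 \<le> i" "1 \<le> j" using addable_ge_1[OF assms(2)] by auto
  have finite: "finite (corners (insert (i, j) D))"
    using finite_corners[OF young_insert_addable[OF assms(2)]] .
  have "corners D = (corners (insert (i, j) D) - {(i, j)}) \<union> ?old"
      "(corners (insert (i, j) D) - {(i, j)}) \<inter> ?old = {}"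
    unfolding corners_insert_Diff[OF assms] by blast+
  then have "mset_set (corners D) = mset_set (corners (insert (i, j) D) - {(i, j)}) + mset_set ?old"
    using finite mset_set_Union[of "corners (insert (i, j) D) - {(i, j)}" ?old] by simp
  moreover have "mset_set ?old = (if (i, j - 1) \<in> corners D then {#(i, j - 1)#} else {#}) +
      (if (i - 1, j) \<in> corners D then {#(i - 1, j)#} else {#})"
    using ij by (subst filter_mset_mset_set[symmetric]) auto
  moreover have "mset_set (corners (insert (i, j) D)) =
      add_mset (i, j) (mset_set (corners (insert (i, j) D) - {(i, j)}))"
    using mset_set.remove[OF finite corner_insert_addable[OF assms]] .
  moreover have "HD (i, j - 1) = HD (i, j) + 1" "HD (i - 1, j) = HD (i, j) - 1"
    using ij by (simp_all add: HD_def of_nat_diff)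
  ultimately show ?thesis
    by (simp add: corner_contents_def add_mset_commute)
qed

text \<open>
  Adding a box either creates the addable box below it or destroys the corner to its left, and these
  two boxes have the same content; likewise for the box to its right and the corner above it.
\<close>
lemma contents_insert:
  assumes "young D" "b \<in> addable D"
  shows "addable_contents (insert b D) + corner_contents D + {#HD b, HD b#} =
    addable_contents D + corner_contents (insert b D) + {#HD b + 1, HD b - 1#}"
proof -
  obtain i j where coords: "b = (i, j)" by force
  have "addable_contents (insert b D) + corner_contents D + {#HD b, HD b#} =
      (addable_contents (insert b D) + {#HD b#}) + (corner_contents D + {#HD b#})"
    by simp
  then show ?thesis
    using assms(2) unfolding coords
    by (simp only: addable_contents_insert[OF assms(1)] corner_contents_insert[OF assms(1)]) simp
qed

lemma card_addable:
  assumes "young D"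
  shows "card (addable D) = card (corners D) + 1"
  using assms
proof (induction rule: young_induct)
  case (insert b D)
  then show ?case
    using arg_cong[OF contents_insert[OF insert.hyps(1,2)], of size]
    by (simp add: addable_contents_def corner_contents_def)
qed (simp add: addable_empty corners_empty)

section \<open>Partial fractions\<close>

lemma lagrange_interpolation:
  fixes p :: "'a::field poly"
  assumes "finite X" "degree p < card X"
  shows "poly p z = (\<Sum>x\<in>X. poly p x * (\<Prod>y\<in>X - {x}. (z - y) / (x - y)))"
proof -
  define r where "r x = smult (poly p x) (\<Prod>y\<in>X - {x}. smult (1 / (x - y)) [:- y, 1:])" for x
  have poly_r: "poly (r x) w = poly p x * (\<Prod>y\<in>X - {x}. (w - y) / (x - y))" for x w
    by (simp add: r_def poly_prod diff_divide_distrib)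
  have "degree (r x) \<le> card X - 1" if "x \<in> X" for x
  proof -
    have "degree (r x) \<le> degree (\<Prod>y\<in>X - {x}. smult (1 / (x - y)) [:- y, 1:])"
      unfolding r_def by (rule degree_smult_le)
    also have "\<dots> \<le> (\<Sum>y\<in>X - {x}. (degree \<circ> (\<lambda>y. smult (1 / (x - y)) [:- y, 1:])) y)"
      using assms(1) by (intro degree_prod_sum_le) simp
    also have "\<dots> \<le> (\<Sum>y\<in>X - {x}. 1)"
      by (intro sum_mono) simp
    finally show ?thesis using that assms(1) by simp
  qed
  then have "degree (\<Sum>x\<in>X. r x) < card X"
    using degree_sum_le[OF assms(1), of r "card X - 1"] assms(2) by force
  moreover have "poly p x = poly (\<Sum>x\<in>X. r x) x" if "x \<in> X" for x
  proof -
    have "poly (r y) x = (if y = x then poly p x else 0)" if "y \<in> X" for y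
      using \<open>x \<in> X\<close> assms(1) by (auto simp: poly_r)
    then show ?thesis using \<open>x \<in> X\<close> assms(1) by (simp add: poly_sum)
  qed
  ultimately have "p = (\<Sum>x\<in>X. r x)"
    using assms(2) by (intro poly_eqI_degree[of X]) auto
  then show ?thesis by (metis (no_types, lifting) poly_r poly_sum sum.cong)
qed

lemma interpolation_at_reciprocals:
  fixes p :: "'b::field poly" and v :: "'a \<Rightarrow> 'b"
  assumes "finite C" "degree p \<le> card C" "inj_on v C" and nonzero: "\<And>c. c \<in> C \<Longrightarrow> v c \<noteq> 0"
  shows "poly p z = poly p 0 * (\<Prod>c\<in>C. 1 - v c * z) +
    (\<Sum>c\<in>C. poly p (1 / v c) * (v c * z * (\<Prod>d\<in>C - {c}. (1 - v d * z) / (1 - v d / v c))))"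
proof -
  let ?r = "\<lambda>c. 1 / v c"
  have inj: "inj_on ?r C" using assms(3) by (auto simp: inj_on_def)
  have nodes: "finite (?r ` C)" "0 \<notin> ?r ` C" "card (?r ` C) = card C"
    using assms(1) nonzero by (auto simp: card_image[OF inj])
  have ratio: "(z - 1 / w) / (1 / x - 1 / w) = (1 - w * z) / (1 - w / x)"
    if "x \<noteq> 0" "w \<noteq> 0" "w \<noteq> x" for w x
    using that by (simp add: divide_simps) (simp add: algebra_simps)
  have "degree p < card (insert 0 (?r ` C))" using nodes assms(2) by simp
  note lagrange_interpolation[OF _ this, of z]
  also have "(\<Sum>x\<in>insert 0 (?r ` C). poly p x * (\<Prod>y\<in>insert 0 (?r ` C) - {x}. (z - y) / (x - y))) =
      poly p 0 * (\<Prod>y\<in>?r ` C. (z - y) / (0 - y)) +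
      (\<Sum>x\<in>?r ` C. poly p x * (\<Prod>y\<in>insert 0 (?r ` C) - {x}. (z - y) / (x - y)))"
    using nodes(1,2) by simp
  also have "(\<Prod>y\<in>?r ` C. (z - y) / (0 - y)) = (\<Prod>c\<in>C. 1 - v c * z)"
    unfolding prod.reindex[OF inj] using nonzero by (intro prod.cong) (auto simp: field_simps)
  also have "(\<Sum>x\<in>?r ` C. poly p x * (\<Prod>y\<in>insert 0 (?r ` C) - {x}. (z - y) / (x - y))) =
      (\<Sum>c\<in>C. poly p (?r c) * (v c * z * (\<Prod>d\<in>C - {c}. (1 - v d * z) / (1 - v d / v c))))"
    unfolding sum.reindex[OF inj] comp_def
  proof (intro sum.cong refl arg_cong[where f = "\<lambda>y. _ * y"])
    fix c assume c_in: "c \<in> C"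
    have others: "insert 0 (?r ` C) - {?r c} = insert 0 (?r ` (C - {c}))"
      using c_in nonzero inj by (auto simp: inj_on_def)
    have "(\<Prod>y\<in>?r ` (C - {c}). (z - y) / (?r c - y)) = (\<Prod>d\<in>C - {c}. (1 - v d * z) / (1 - v d / v c))"
      unfolding prod.reindex[OF inj_on_subset[OF inj Diff_subset]] comp_def
      by (intro prod.cong refl ratio) (use c_in nonzero assms(3) in \<open>auto simp: inj_on_def\<close>)
    then show "(\<Prod>y\<in>insert 0 (?r ` C) - {?r c}. (z - y) / (?r c - y)) =
        v c * z * (\<Prod>d\<in>C - {c}. (1 - v d * z) / (1 - v d / v c))"
      unfolding others using assms(1) nonzero by (subst prod.insert) (auto simp: mult.commute)
  qed
  finally show ?thesis using nodes(1) by simp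
qed

lemma partial_fractions:
  fixes u :: "'a \<Rightarrow> 'c::field" and v :: "'b \<Rightarrow> 'c"
  assumes "finite A" "finite C" "card A \<le> card C" "inj_on v C"
    and nonzero: "\<And>c. c \<in> C \<Longrightarrow> v c \<noteq> 0" and not_pole: "\<And>c. c \<in> C \<Longrightarrow> v c * z \<noteq> 1"
  shows "(\<Prod>a\<in>A. 1 - u a * z) / (\<Prod>c\<in>C. 1 - v c * z) =
    1 + (\<Sum>c\<in>C. (\<Prod>a\<in>A. 1 - u a / v c) / (\<Prod>d\<in>C - {c}. 1 - v d / v c) * (v c * z / (1 - v c * z)))"
proof -
  define p where "p = (\<Prod>a\<in>A. [:1, - u a:])"
  have poly_p: "poly p x = (\<Prod>a\<in>A. 1 - u a * x)" for x
    by (simp add: p_def poly_prod mult.commute)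
  have "degree p \<le> (\<Sum>a\<in>A. 1)"
    unfolding p_def by (rule order.trans[OF degree_prod_sum_le[OF assms(1)]], rule sum_mono) simp
  then have "degree p \<le> card C" using assms(3) by simp
  note expansion = interpolation_at_reciprocals[OF assms(2) this assms(4) nonzero, of z]
  have "(\<Prod>d\<in>C - {c}. (1 - v d * z) / (1 - v d / v c)) / (\<Prod>d\<in>C. 1 - v d * z) =
      1 / ((\<Prod>d\<in>C - {c}. 1 - v d / v c) * (1 - v c * z))" if "c \<in> C" for c
    using not_pole assms(2) by (subst prod.remove[OF assms(2) that]) (auto simp: prod_dividef)
  then have "poly p (1 / v c) * (v c * z * (\<Prod>d\<in>C - {c}. (1 - v d * z) / (1 - v d / v c)))
        / (\<Prod>d\<in>C. 1 - v d * z) =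
      poly p (1 / v c) / (\<Prod>d\<in>C - {c}. 1 - v d / v c) * (v c * z / (1 - v c * z))" if "c \<in> C" for c
    using that by (simp only: times_divide_eq_right[symmetric]) (simp add: mult_ac)
  moreover have "(\<Prod>c\<in>C. 1 - v c * z) \<noteq> 0" using not_pole assms(2) by auto
  ultimately show ?thesis
    using expansion by (simp add: poly_p add_divide_distrib sum_divide_distrib)
qed

section \<open>Content ratios\<close>

locale qwb =
  fixes P :: qwb_param
  assumes generic: "generic_params P" and eta_zeta: "eta_zeta_ok P"
begin

abbreviation "q \<equiv> qpar P"
abbreviation "\<alpha> \<equiv> alp P"
abbreviation "\<beta> \<equiv> bet P"
abbreviation "\<kappa> \<equiv> kap P"
abbreviation "\<theta> \<equiv> tht P"
abbreviation "\<eta> \<equiv> eta P"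
abbreviation "\<zeta> \<equiv> zeta P"

lemma params_nonzero [simp]: "\<alpha> \<noteq> 0" "\<beta> \<noteq> 0" "\<kappa> \<noteq> 0" "\<theta> \<noteq> 0" "\<alpha> + \<beta> \<noteq> 0"
  using generic by (auto simp: generic_params_def)

lemma q_nonzero [simp]: "q \<noteq> 0"
  by (simp add: qpar_def)

lemma beta_eq: "\<beta> = - q * \<alpha>"
  by (simp add: qpar_def)

lemma q_powi_eq_1_iff [simp]: "q powi k = 1 \<longleftrightarrow> k = 0"
  using generic by (auto simp: generic_params_def)

lemma q_neq_1 [simp]: "q \<noteq> 1"
  using q_powi_eq_1_iff[of 1] by simp

lemma q_powi_inject [simp]: "q powi k = q powi l \<longleftrightarrow> k = l"
  using q_powi_eq_1_iff[of "k - l"] by (auto simp: power_int_diff)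

lemma q_powi_neq_theta [simp]: "q powi k \<noteq> - \<theta> * q powi l"
proof
  assume "q powi k = - \<theta> * q powi l"
  then have "\<theta> = - (q powi (k - l))" by (simp add: power_int_diff field_simps)
  then show False using generic unfolding generic_params_def by blast
qed

lemma Ffun_eq: "Ffun P x = (1 - q * x) * (1 - x / q) / (1 - x)\<^sup>2"
  by (simp add: Ffun_def qpar_def field_simps)

definition qfac :: "int \<Rightarrow> complex" where
  "qfac k = (if k = 0 then 1 else 1 - q powi k)"

lemma qfac_nonzero [simp]: "qfac k \<noteq> 0"
  by (simp add: qfac_def)

text \<open>
  For \<open>k\<close> the content of an addable box \<open>b\<close>, this is the reciprocal of the coefficient of
  \<open>(B, S\<^sub>b, W\<^sub>b)\<close> in \<open>E (B, S, W)\<close>, up to a factor that does not depend on \<open>b\<close>.  The convention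
  \<^term>\<open>qfac 0 = 1\<close> omits the factor of \<open>b\<close> itself, and makes sense of the ratio at corners too.
\<close>
definition content_ratio :: "box set \<Rightarrow> int \<Rightarrow> complex" where
  "content_ratio D k =
    (\<Prod>a\<in>#addable_contents D. qfac (a - k)) / (\<Prod>d\<in>#corner_contents D. qfac (d - k))"

lemma content_ratio_eq:
  "content_ratio D k = (\<Prod>a\<in>addable D. qfac (HD a - k)) / (\<Prod>d\<in>corners D. qfac (HD d - k))"
  by (simp add: content_ratio_def addable_contents_def corner_contents_def prod_unfold_prod_mset
      image_mset.compositionality comp_def)

lemma content_ratio_nonzero: "content_ratio D k \<noteq> 0"
  by (auto simp: content_ratio_def)

lemma prod_qfac_avoiding: "(\<And>a. a \<in> A \<Longrightarrow> HD a \<noteq> k) \<Longrightarrow>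
    (\<Prod>a\<in>A. qfac (HD a - k)) = (\<Prod>a\<in>A. 1 - q powi (HD a - k))"
  by (rule prod.cong) (auto simp: qfac_def)

lemma prod_qfac_meeting:
  assumes "inj_on HD A" "finite A" "b \<in> A"
  shows "(\<Prod>a\<in>A. qfac (HD a - HD b)) = (\<Prod>a\<in>A - {b}. 1 - q powi (HD a - HD b))"
proof -
  have "(\<Prod>a\<in>A. qfac (HD a - HD b)) = (\<Prod>a\<in>A - {b}. qfac (HD a - HD b))"
    using assms(2,3) by (subst prod.remove) (auto simp: qfac_def)
  then show ?thesis
    using assms(1,3) by (subst (asm) prod_qfac_avoiding[of "A - {b}"]) (auto simp: inj_on_def)
qed

lemma content_ratio_addable:
  assumes "young D" "b \<in> addable D"
  shows "content_ratio D (HD b) =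
    (\<Prod>a\<in>addable D - {b}. 1 - q powi (HD a - HD b)) / (\<Prod>d\<in>corners D. 1 - q powi (HD d - HD b))"
  using prod_qfac_meeting[OF inj_on_HD_addable[OF assms(1)] finite_addable[OF assms(1)] assms(2)]
    prod_qfac_avoiding[of "corners D" "HD b"] HD_corner_neq_addable[OF assms]
  by (simp add: content_ratio_eq)

lemma content_ratio_corner:
  assumes "young D" "c \<in> corners D"
  shows "content_ratio D (HD c) =
    (\<Prod>a\<in>addable D. 1 - q powi (HD a - HD c)) / (\<Prod>d\<in>corners D - {c}. 1 - q powi (HD d - HD c))"
  using prod_qfac_meeting[OF inj_on_HD_corners[OF assms(1)] finite_corners[OF assms(1)] assms(2)]
    prod_qfac_avoiding[of "addable D" "HD c"] HD_corner_neq_addable[OF assms(1) _ assms(2)]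
  by (fastforce simp add: content_ratio_eq)

lemma content_ratio_insert:
  assumes "young D" "c \<in> addable D"
  shows "content_ratio (insert c D) k * (qfac (HD c - k))\<^sup>2 =
    content_ratio D k * (qfac (HD c + 1 - k) * qfac (HD c - 1 - k))"
proof -
  have "(\<Prod>d\<in>#corner_contents X. qfac (d - k)) \<noteq> 0" for X
    by (auto simp: prod_mset_zero_iff)
  moreover have
    "(\<Prod>a\<in>#addable_contents (insert c D). qfac (a - k)) * (\<Prod>d\<in>#corner_contents D. qfac (d - k)) *
        (qfac (HD c - k))\<^sup>2 =
      (\<Prod>a\<in>#addable_contents D. qfac (a - k)) * (\<Prod>d\<in>#corner_contents (insert c D). qfac (d - k)) *
        (qfac (HD c + 1 - k) * qfac (HD c - 1 - k))"
    using arg_cong[OF contents_insert[OF assms], of "\<lambda>M. \<Prod>a\<in>#M. qfac (a - k)"]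
    by (simp add: power2_eq_square mult_ac)
  ultimately show ?thesis by (simp add: content_ratio_def field_simps)
qed

lemma content_ratio_remove_corner:
  assumes "young D" "c \<in> corners D"
  shows "content_ratio D k * (qfac (HD c - k))\<^sup>2 =
    content_ratio (D - {c}) k * (qfac (HD c + 1 - k) * qfac (HD c - 1 - k))"
  using content_ratio_insert[OF young_remove_corner[OF assms(2)] addable_remove_corner[OF assms]]
  by (simp add: insert_absorb corner_in[OF assms(2)])

lemma content_ratio_remove_same_corner:
  assumes "young D" "c \<in> corners D"
  shows "content_ratio D (HD c) = (1 - q) * (1 - 1 / q) * content_ratio (D - {c}) (HD c)"
  using content_ratio_remove_corner[OF assms, of "HD c"]
  by (simp add: qfac_def power_int_minus field_simps)

lemma content_ratio_remove_distant_corner: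
  assumes "young D" "b \<in> addable D" "c \<in> corners D" "\<not> aligned b c"
  shows "content_ratio D (HD b) = Ffun P (q powi (HD c - HD b)) * content_ratio (D - {c}) (HD b)"
proof -
  let ?x = "q powi (HD c - HD b)"
  have shift: "q powi (HD c + 1 - HD b) = q * ?x" "q powi (HD c - 1 - HD b) = ?x / q"
    using power_int_add[of q "HD c - HD b" 1] power_int_diff[of q "HD c - HD b" 1]
    by (simp_all add: algebra_simps)
  have "\<not> \<bar>HD b - HD c\<bar> \<le> 1"
    using HD_adjacent_corner_aligned[OF assms(1-3)] assms(4) aligned_commute by blast
  then have "content_ratio D (HD b) * (1 - ?x)\<^sup>2 =
      content_ratio (D - {c}) (HD b) * ((1 - q * ?x) * (1 - ?x / q))"
    using content_ratio_remove_corner[OF assms(1,3), of "HD b"]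
    by (auto simp: qfac_def simp flip: shift split: if_splits)
  then show ?thesis
    using HD_corner_neq_addable[OF assms(1-3)] by (simp add: Ffun_eq eq_divide_eq mult_ac)
qed

definition qpole :: "int \<Rightarrow> complex" where
  "qpole k = q powi k / (1 - q powi k)"

lemma prod_addable_Diff:
  assumes "young D" "b \<in> addable D" "c \<in> corners D"
  shows "(\<Prod>a\<in>addable D - {b}. 1 - q powi (HD a - HD c)) =
    - qpole (HD c - HD b) * (\<Prod>a\<in>addable D. 1 - q powi (HD a - HD c))"
proof -
  define x where "x = q powi (HD c - HD b)"
  have x: "x \<noteq> 0" "x \<noteq> 1" using HD_corner_neq_addable[OF assms] by (auto simp: x_def)
  have "q powi (HD b - HD c) = 1 / x"
    using power_int_minus[of q "HD c - HD b"] by (simp add: x_def field_simps)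
  then have "(\<Prod>a\<in>addable D. 1 - q powi (HD a - HD c)) =
      (1 - 1 / x) * (\<Prod>a\<in>addable D - {b}. 1 - q powi (HD a - HD c))"
    by (subst prod.remove[OF finite_addable[OF assms(1)] assms(2)]) simp
  then show ?thesis
    using x unfolding qpole_def x_def[symmetric] by (simp add: divide_simps) algebra
qed

lemma sum_qpole_content_ratio:
  assumes "young D" "b \<in> addable D" "b' \<in> addable D"
  shows "1 - (\<Sum>c\<in>corners D. qpole (HD c - HD b) * qpole (HD c - HD b') * content_ratio D (HD c)) =
    (if b = b' then content_ratio D (HD b) else 0)"
proof -
  let ?u = "\<lambda>x. q powi HD x"
  let ?A = "addable D - {b}" and ?C = "corners D"
  define z where "z = 1 / ?u b'"
  have finite: "finite ?A" "finite ?C" using finite_addable finite_corners assms(1) by auto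
  have card: "card ?A \<le> card ?C" using card_addable[OF assms(1)] assms(2) finite by simp
  have inj: "inj_on ?u ?C" using inj_on_HD_corners[OF assms(1)] by (auto simp: inj_on_def)
  have u_mult_z: "?u x * z = q powi (HD x - HD b')" for x by (simp add: z_def power_int_diff)
  have u_divide: "?u x / ?u y = q powi (HD x - HD y)" for x y by (simp add: power_int_diff)
  have "(if b = b' then content_ratio D (HD b) else 0) =
      (\<Prod>a\<in>?A. 1 - ?u a * z) / (\<Prod>c\<in>?C. 1 - ?u c * z)"
    using assms finite by (auto simp: u_mult_z content_ratio_addable)
  also have "\<dots> = 1 + (\<Sum>c\<in>?C. (\<Prod>a\<in>?A. 1 - ?u a / ?u c) / (\<Prod>d\<in>?C - {c}. 1 - ?u d / ?u c)
      * (?u c * z / (1 - ?u c * z)))"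
    using HD_corner_neq_addable[OF assms(1,3)]
    by (intro partial_fractions[OF finite card inj]) (auto simp: u_mult_z)
  also have "\<dots> = 1 - (\<Sum>c\<in>?C. qpole (HD c - HD b) * qpole (HD c - HD b') * content_ratio D (HD c))"
    unfolding diff_conv_add_uminus sum_negf[symmetric]
    by (intro arg_cong2[of _ _ _ _ "(+)"] sum.cong refl)
       (simp add: u_mult_z u_divide prod_addable_Diff[OF assms(1,2)]
         content_ratio_corner[OF assms(1)] qpole_def[of "HD _ - HD b'"], simp add: mult_ac)
  finally show ?thesis by simp
qed

section \<open>Matrix entries of the generators\<close>

lemma eta_mult_inverse: "x \<noteq> 0 \<Longrightarrow> x \<noteq> 1 \<Longrightarrow> \<eta> x * \<eta> (1 / x) = - (\<alpha> * \<beta>) * Ffun P x"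
  and zeta_mult_inverse: "x \<noteq> 0 \<Longrightarrow> x \<noteq> 1 \<Longrightarrow> \<zeta> x * \<zeta> (1 / x) = - (\<alpha> * \<beta>) * Ffun P x"
  using eta_zeta unfolding eta_zeta_ok_def by auto

definition gen_diag :: "complex \<Rightarrow> complex" where
  "gen_diag x = (\<alpha> + \<beta>) / (1 - x)"

lemma gen_diag_q: "gen_diag q = \<alpha>"
  unfolding gen_diag_def beta_eq by (simp add: divide_simps) (simp add: algebra_simps)

lemma gen_diag_inverse_q: "gen_diag (1 / q) = \<beta>"
  unfolding gen_diag_def beta_eq by (simp add: divide_simps) (simp add: algebra_simps)

lemma Ffun_q: "Ffun P q = 0" and Ffun_inverse_q: "Ffun P (1 / q) = 0"
  by (simp_all add: Ffun_eq)

text \<open>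
  Boxes of consecutive entries that are aligned are adjacent, and then the generic diagonal entry
  specialises to \<open>\<alpha>\<close> or \<open>\<beta>\<close>, so only the off-diagonal entry needs a case distinction.
\<close>
definition inv_diag :: "box \<Rightarrow> box \<Rightarrow> complex" where
  "inv_diag c d = (\<alpha> + \<beta> - gen_diag (q powi (HD d - HD c))) / (\<alpha> * \<beta>)"

definition inv_offdiag :: "box \<Rightarrow> box \<Rightarrow> complex" where
  "inv_offdiag c d = (if aligned c d then 0 else - \<eta> (q powi (HD d - HD c)) / (\<alpha> * \<beta>))"

lemma inv_diag_eq:
  assumes "HD d \<noteq> HD c"
  shows "inv_diag c d = (1 - q) / (q * \<alpha>) * qpole (HD d - HD c)"
proof -
  have "(\<alpha> + \<beta> - gen_diag x) / (\<alpha> * \<beta>) = (1 - q) / (q * \<alpha>) * (x / (1 - x))" if "x \<noteq> 1" for x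
    unfolding gen_diag_def beta_eq using that by (simp add: divide_simps) algebra
  then show ?thesis using assms by (simp add: inv_diag_def qpole_def)
qed

lemma inv_offdiag_mult:
  assumes "\<not> aligned b c" "HD b \<noteq> HD c"
  shows "- (\<alpha> * \<beta>) * (inv_offdiag c b * inv_offdiag b c) = Ffun P (q powi (HD c - HD b))"
proof -
  let ?x = "q powi (HD c - HD b)"
  have inverse: "q powi (HD b - HD c) = 1 / ?x"
    using power_int_minus[of q "HD c - HD b"] by (simp add: field_simps)
  show ?thesis
    using assms eta_mult_inverse[of ?x] unfolding inv_offdiag_def inverse aligned_commute[of c b]
    by (simp add: field_simps)
qed

lemma sum_inv_diag_content_ratio:
  assumes "young D" "b \<in> addable D" "b' \<in> addable D"
  shows "1 - \<alpha> * \<beta> * (\<Sum>d\<in>corners D. inv_diag b d * inv_diag b' d * content_ratio (D - {d}) (HD d)) =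
    (if b = b' then content_ratio D (HD b) else 0)"
proof -
  have "\<alpha> * \<beta> * (inv_diag b d * inv_diag b' d * content_ratio (D - {d}) (HD d)) =
      qpole (HD d - HD b) * qpole (HD d - HD b') * content_ratio D (HD d)" if "d \<in> corners D" for d
  proof -
    have "\<alpha> * \<beta> * ((1 - q) / (q * \<alpha>) * x * ((1 - q) / (q * \<alpha>) * y) * r) =
        x * y * ((1 - q) * (1 - 1 / q) * r)" for x y r
      unfolding beta_eq by (simp add: divide_simps) algebra
    then show ?thesis
      using HD_corner_neq_addable[OF assms(1) _ that] assms(2,3)
      by (simp add: inv_diag_eq content_ratio_remove_same_corner[OF assms(1) that])
  qed
  then show ?thesis
    unfolding sum_distrib_left sum_qpole_content_ratio[OF assms, symmetric] by simp
qed

end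

section \<open>Standard paths and the relative trace\<close>

primrec std_path :: "box list \<Rightarrow> bool" where
  "std_path [] \<longleftrightarrow> True"
| "std_path (b # L) \<longleftrightarrow> b \<in> addable (set L) \<and> std_path L"

lemma std_path_young: "std_path L \<Longrightarrow> young (set L)"
  by (cases L) (simp_all add: young_insert_addable young_empty)

lemma std_path_distinct: "std_path L \<Longrightarrow> distinct L"
  by (induction L) (auto dest: addable_notin)

lemma std_path_hd_corner: "std_path (b # L) \<Longrightarrow> b \<in> corners (set (b # L))"
  using corner_insert_addable std_path_young by simp

lemma std_path_swap:
  assumes "std_path (c # d # U)" "\<not> aligned c d"
  shows "std_path (d # c # U)"
proof -
  have d_addable: "d \<in> addable (set U)" and c_addable: "c \<in> addable (insert d (set U))"
    and tail: "std_path U"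
    using assms(1) by auto
  have "d \<in> corners (insert d (set U))"
    using corner_insert_addable[OF std_path_young[OF tail] d_addable] .
  then have "c \<in> addable (set U)"
    using addable_after_removing_corner[OF young_insert_addable[OF d_addable] c_addable _ assms(2)]
      addable_notin[OF d_addable] by simp
  moreover from this have "d \<in> addable (insert c (set U))"
    using d_addable assms(2)
    unfolding addable_iff_minimal[OF std_path_young[OF tail]]
      addable_iff_minimal[OF young_insert_addable[OF \<open>c \<in> addable (set U)\<close>]] aligned_def
    by blast
  ultimately show ?thesis using tail by simp
qed

context qwb
begin

text \<open>
  The generators act on the span of the standard paths.  To avoid finiteness conditions, the
  operators below are the transposed ones, acting on arbitrary functions of paths.  A path lists the
  boxes of a standard tableau starting with the largest entry, hence \<^term>\<open>hinv_dual i\<close> is the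
  transpose of the inverse of the generator with index \<^term>\<open>i + 1\<close>.
\<close>
fun hinv_dual :: "nat \<Rightarrow> (box list \<Rightarrow> complex) \<Rightarrow> box list \<Rightarrow> complex" where
  "hinv_dual 0 F (c # d # U) = inv_diag c d * F (c # d # U) + inv_offdiag c d * F (d # c # U)"
| "hinv_dual (Suc i) F (c # U) = hinv_dual i (\<lambda>V. F (c # V)) U"
| "hinv_dual i F L = F L"

primrec Rh_dual :: "nat \<Rightarrow> (box list \<Rightarrow> complex) \<Rightarrow> box list \<Rightarrow> complex" where
  "Rh_dual 0 F = F"
| "Rh_dual (Suc k) F = hinv_dual k (Rh_dual k F)"

primrec Lh_dual :: "nat \<Rightarrow> (box list \<Rightarrow> complex) \<Rightarrow> box list \<Rightarrow> complex" where
  "Lh_dual 0 F = F"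
| "Lh_dual (Suc k) F = Lh_dual k (hinv_dual k F)"

lemma hinv_dual_cong:
  assumes "std_path L" "\<And>V. std_path V \<Longrightarrow> set V = set L \<Longrightarrow> F V = G V"
  shows "hinv_dual i F L = hinv_dual i G L"
  using assms
proof (induction i F L arbitrary: G rule: hinv_dual.induct)
  case (1 F c d U)
  have "inv_offdiag c d * F (d # c # U) = inv_offdiag c d * G (d # c # U)"
  proof (cases "aligned c d")
    case False
    then show ?thesis using std_path_swap[OF "1.prems"(1)] "1.prems"(2)[of "d # c # U"] by auto
  qed (simp add: inv_offdiag_def)
  then show ?case using 1 by simp
next
  case (2 i F c U)
  have "hinv_dual i (\<lambda>V. F (c # V)) U = hinv_dual i (\<lambda>V. G (c # V)) U"
    using "2.prems" by (intro "2.IH") auto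
  then show ?case by simp
qed auto

lemma Rh_dual_cong:
  assumes "std_path L" "\<And>V. std_path V \<Longrightarrow> set V = set L \<Longrightarrow> F V = G V"
  shows "Rh_dual i F L = Rh_dual i G L"
  using assms
proof (induction i arbitrary: L)
  case (Suc i)
  then show ?case unfolding Rh_dual.simps by (intro hinv_dual_cong) auto
qed simp

lemma Lh_dual_cong:
  assumes "std_path L" "\<And>V. std_path V \<Longrightarrow> set V = set L \<Longrightarrow> F V = G V"
  shows "Lh_dual i F L = Lh_dual i G L"
  using assms
proof (induction i arbitrary: F G)
  case (Suc i)
  have "hinv_dual i F V = hinv_dual i G V" if "std_path V" "set V = set L" for V
    using that Suc.prems(2) by (intro hinv_dual_cong) auto
  then show ?case unfolding Lh_dual.simps by (rule Suc.IH[OF Suc.prems(1)])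
qed simp

lemma hinv_dual_sum: "hinv_dual i (\<lambda>V. \<Sum>k\<in>K. a k * G k V) L = (\<Sum>k\<in>K. a k * hinv_dual i (G k) L)"
  by (induction i "\<lambda>V. \<Sum>k\<in>K. a k * G k V" L arbitrary: G rule: hinv_dual.induct)
     (auto simp: sum_distrib_left sum.distrib algebra_simps)

lemma Rh_dual_sum: "Rh_dual i (\<lambda>V. \<Sum>k\<in>K. a k * G k V) L = (\<Sum>k\<in>K. a k * Rh_dual i (G k) L)"
proof (induction i arbitrary: L)
  case (Suc i)
  have "Rh_dual i (\<lambda>V. \<Sum>k\<in>K. a k * G k V) = (\<lambda>V. \<Sum>k\<in>K. a k * Rh_dual i (G k) V)"
    using Suc.IH by auto
  then show ?case by (simp add: hinv_dual_sum)
qed simp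

lemma Rh_dual_Suc_Cons: "Rh_dual (Suc i) G (c # U) = Rh_dual i (\<lambda>V. hinv_dual 0 G (c # V)) U"
proof (induction i arbitrary: U)
  case (Suc i)
  have "Rh_dual (Suc (Suc i)) G (c # U) = hinv_dual i (\<lambda>V. Rh_dual (Suc i) G (c # V)) U"
    by simp
  then show ?case using Suc.IH by (simp only: Rh_dual.simps)
qed simp

lemma Lh_dual_Suc_Cons:
  "Lh_dual (Suc i) F (c # d # U) =
    inv_diag c d * Lh_dual i (\<lambda>V. F (c # V)) (d # U) +
    inv_offdiag c d * Lh_dual i (\<lambda>V. F (d # V)) (c # U)"
proof (induction i arbitrary: F)
  case (Suc i)
  have "Lh_dual (Suc (Suc i)) F (c # d # U) = Lh_dual (Suc i) (hinv_dual (Suc i) F) (c # d # U)"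
    by simp
  then show ?case unfolding Suc.IH by simp
qed simp

definition Rh_sum :: "nat \<Rightarrow> (nat \<Rightarrow> box list \<Rightarrow> complex) \<Rightarrow> box list \<Rightarrow> complex" where
  "Rh_sum n Y L = (\<Sum>i<n. (- (\<alpha> * \<beta>)) ^ i * Rh_dual i (Y i) L)"

lemma Rh_sum_Suc_Cons:
  "Rh_sum (Suc n) Y (c # U) =
    Y 0 (c # U) - \<alpha> * \<beta> * Rh_sum n (\<lambda>i V. hinv_dual 0 (Y (Suc i)) (c # V)) U"
  unfolding Rh_sum_def sum.lessThan_Suc_shift Rh_dual_Suc_Cons
  by (simp add: sum_distrib_left sum_negf mult_ac)

lemma Rh_sum_cong:
  assumes "std_path L" "\<And>i V. i < n \<Longrightarrow> std_path V \<Longrightarrow> set V = set L \<Longrightarrow> Y i V = Z i V"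
  shows "Rh_sum n Y L = Rh_sum n Z L"
proof -
  have "Rh_dual i (Y i) L = Rh_dual i (Z i) L" if "i < n" for i
    using assms that by (intro Rh_dual_cong) auto
  then show ?thesis by (simp add: Rh_sum_def)
qed

lemma Rh_sum_sum: "Rh_sum n (\<lambda>i V. \<Sum>k\<in>K. a k * Y k i V) L = (\<Sum>k\<in>K. a k * Rh_sum n (Y k) L)"
  unfolding Rh_sum_def Rh_dual_sum sum_distrib_left
  by (subst sum.swap) (simp add: mult_ac)

lemma Rh_sum_linear:
  "Rh_sum n (\<lambda>i V. a * Y i V + b * Z i V) L = a * Rh_sum n Y L + b * Rh_sum n Z L"
  using Rh_sum_sum[of n "\<lambda>k. if k then a else b" "\<lambda>k. if k then Y else Z" UNIV L]
  by (simp add: UNIV_bool add.commute)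

lemma Rh_sum_eq_0:
  assumes "std_path L" "\<And>i V. i < n \<Longrightarrow> std_path V \<Longrightarrow> set V = set L \<Longrightarrow> Y i V = 0"
  shows "Rh_sum n Y L = 0"
proof -
  have "Rh_sum n Y L = Rh_sum n (\<lambda>i V. 0 * Y i V + 0 * Y i V) L"
    using assms(2) by (intro Rh_sum_cong[OF assms(1)]) simp
  then show ?thesis unfolding Rh_sum_linear by simp
qed

fun move_hd :: "box \<Rightarrow> box \<Rightarrow> (box list \<Rightarrow> complex) \<Rightarrow> box list \<Rightarrow> complex" where
  "move_hd b b' F (c # U) = (if c = b then F (b' # U) else 0)"
| "move_hd b b' F [] = 0"

definition rel_trace :: "box \<Rightarrow> box \<Rightarrow> (box list \<Rightarrow> complex) \<Rightarrow> box list \<Rightarrow> complex" where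
  "rel_trace b b' F L = Rh_sum (length L) (\<lambda>i. move_hd b b' (Lh_dual i F)) L"

lemma rel_trace_hd_eq:
  assumes "std_path U" "b \<notin> set U"
  shows "rel_trace b b' F (b # U) = F (b' # U) - \<alpha> * \<beta> *
    (\<Sum>d\<in>corners (set U). inv_diag b d *
      (inv_diag b' d * rel_trace d d (\<lambda>V. F (b' # V)) U +
       inv_offdiag b' d * rel_trace d b' (\<lambda>V. F (d # V)) U))"
proof -
  let ?G = "\<lambda>x i. Lh_dual i (\<lambda>V. F (x # V))"
  have "hinv_dual 0 (move_hd b b' (Lh_dual (Suc i) F)) (b # V) = (\<Sum>d\<in>corners (set U). inv_diag b d *
      (inv_diag b' d * move_hd d d (?G b' i) V + inv_offdiag b' d * move_hd d b' (?G d i) V))"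
    if "i < length U" "std_path V" "set V = set U" for i V
  proof -
    obtain d W where V_eq: "V = d # W" using \<open>i < length U\<close> \<open>set V = set U\<close> by (cases V) auto
    then have d_corner: "d \<in> corners (set U)" using std_path_hd_corner that(2,3) by metis
    have "(\<Sum>x\<in>corners (set U). inv_diag b x *
          (inv_diag b' x * move_hd x x (?G b' i) V + inv_offdiag b' x * move_hd x b' (?G x i) V)) =
        (\<Sum>x\<in>corners (set U). if d = x then inv_diag b d *
          (inv_diag b' d * ?G b' i (d # W) + inv_offdiag b' d * ?G d i (b' # W)) else 0)"
      by (rule sum.cong) (auto simp: V_eq)
    also have "\<dots> = inv_diag b d * Lh_dual (Suc i) F (b' # d # W)"
      using finite_corners[OF std_path_young[OF assms(1)]] d_corner
      by (simp add: Lh_dual_Suc_Cons del: Lh_dual.simps)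
    finally show ?thesis
      using assms(2) corner_in[OF d_corner] by (auto simp: V_eq simp del: Lh_dual.simps)
  qed
  then have "Rh_sum (length U) (\<lambda>i V. hinv_dual 0 (move_hd b b' (Lh_dual (Suc i) F)) (b # V)) U =
      Rh_sum (length U) (\<lambda>i V. \<Sum>d\<in>corners (set U). inv_diag b d *
        (inv_diag b' d * move_hd d d (?G b' i) V + inv_offdiag b' d * move_hd d b' (?G d i) V)) U"
    by (rule Rh_sum_cong[OF assms(1)])
  then show ?thesis
    by (simp add: rel_trace_def Rh_sum_Suc_Cons Rh_sum_sum Rh_sum_linear
        del: hinv_dual.simps Lh_dual.simps(2))
qed

lemma rel_trace_hd_neq:
  assumes "std_path U" "c \<noteq> b"
  shows "rel_trace b b' F (c # U) = - (\<alpha> * \<beta>) * inv_offdiag c b *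
    (inv_diag b' c * rel_trace b c (\<lambda>V. F (b' # V)) U +
     inv_offdiag b' c * rel_trace b b' (\<lambda>V. F (c # V)) U)"
proof -
  let ?G = "\<lambda>x i. Lh_dual i (\<lambda>V. F (x # V))"
  have "hinv_dual 0 (move_hd b b' (Lh_dual (Suc i) F)) (c # V) =
      inv_offdiag c b * inv_diag b' c * move_hd b c (?G b' i) V +
      inv_offdiag c b * inv_offdiag b' c * move_hd b b' (?G c i) V"
    if "i < length U" "set V = set U" for i V
  proof -
    obtain d W where "V = d # W" using \<open>i < length U\<close> \<open>set V = set U\<close> by (cases V) auto
    then show ?thesis
      using assms(2) by (simp add: Lh_dual_Suc_Cons algebra_simps del: Lh_dual.simps)
  qed
  then have "Rh_sum (length U) (\<lambda>i V. hinv_dual 0 (move_hd b b' (Lh_dual (Suc i) F)) (c # V)) U =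
      Rh_sum (length U) (\<lambda>i V. inv_offdiag c b * inv_diag b' c * move_hd b c (?G b' i) V +
        inv_offdiag c b * inv_offdiag b' c * move_hd b b' (?G c i) V) U"
    by (intro Rh_sum_cong[OF assms(1)])
  then show ?thesis
    unfolding Rh_sum_linear using assms(2)
    by (simp add: rel_trace_def Rh_sum_Suc_Cons algebra_simps
        del: hinv_dual.simps Lh_dual.simps(2))
qed

definition rel_trace_diagonal :: "box list \<Rightarrow> bool" where
  "rel_trace_diagonal L \<longleftrightarrow> (\<forall>D b b' F.
    set L = insert b D \<longrightarrow> young D \<longrightarrow> b \<in> addable D \<longrightarrow> b' \<in> addable D \<longrightarrow>
    rel_trace b b' F L = (if b = b' then content_ratio D (HD b) * F L else 0))"

lemma rel_trace_diagonalD: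
  assumes "rel_trace_diagonal L" "set L = insert b D" "young D" "b \<in> addable D" "b' \<in> addable D"
  shows "rel_trace b b' F L = (if b = b' then content_ratio D (HD b) * F L else 0)"
  using assms unfolding rel_trace_diagonal_def by blast

lemma inv_offdiag_mult_rel_trace:
  assumes "rel_trace_diagonal U" "young D" "b' \<in> addable D" "d \<in> corners D"
    and "set U = insert b (D - {d})" "b \<in> addable (D - {d})"
  shows "inv_offdiag b' d * rel_trace b b' F U =
    (if b = b' then inv_offdiag b' d * (content_ratio (D - {d}) (HD b) * F U) else 0)"
proof (cases "aligned b' d")
  case False
  then have "b' \<in> addable (D - {d})" using addable_after_removing_corner[OF assms(2-4)] by blast
  then show ?thesis
    using rel_trace_diagonalD[OF assms(1,5) young_remove_corner[OF assms(4)] assms(6)] by simp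
qed (simp add: inv_offdiag_def)

lemma rel_trace_diagonal_hd_eq:
  assumes tail: "rel_trace_diagonal U" "std_path U"
    and addable: "b \<in> addable (set U)" "b' \<in> addable (set U)"
  shows "rel_trace b b' F (b # U) =
    (if b = b' then content_ratio (set U) (HD b) * F (b # U) else 0)"
proof -
  let ?D = "set U"
  let ?entry = "\<lambda>d. inv_diag b d * inv_diag b' d * content_ratio (?D - {d}) (HD d)"
  note young = std_path_young[OF tail(2)]
  have summand: "rel_trace d d G U = content_ratio (?D - {d}) (HD d) * G U"
      "inv_offdiag b' d * rel_trace d b' G U = 0" if corner: "d \<in> corners ?D" for d G
  proof -
    have set_U: "?D = insert d (?D - {d})" using corner_in[OF corner] by blast
    note remove = young_remove_corner[OF corner] addable_remove_corner[OF young corner]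
    show "rel_trace d d G U = content_ratio (?D - {d}) (HD d) * G U"
      using rel_trace_diagonalD[OF tail(1) set_U remove remove(2)] by simp
    show "inv_offdiag b' d * rel_trace d b' G U = 0"
      using inv_offdiag_mult_rel_trace[OF tail(1) young addable(2) corner set_U remove(2)]
        corner_in[OF corner] addable_notin[OF addable(2)] by auto
  qed
  have "inv_diag b d * (inv_diag b' d * rel_trace d d (\<lambda>V. F (b' # V)) U +
      inv_offdiag b' d * rel_trace d b' (\<lambda>V. F (d # V)) U) = ?entry d * F (b' # U)"
    if "d \<in> corners ?D" for d
    unfolding summand[OF that] by simp
  then have "rel_trace b b' F (b # U) = F (b' # U) - \<alpha> * \<beta> * (\<Sum>d\<in>corners ?D. ?entry d * F (b' # U))"
    unfolding rel_trace_hd_eq[OF tail(2) addable_notin[OF addable(1)]] by (simp only: cong: sum.cong)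
  also have "\<dots> = (1 - \<alpha> * \<beta> * (\<Sum>d\<in>corners ?D. ?entry d)) * F (b' # U)"
    by (subst sum_distrib_right[symmetric]) (simp add: left_diff_distrib)
  finally show ?thesis unfolding sum_inv_diag_content_ratio[OF young addable] by simp
qed

lemma rel_trace_diagonal_hd_neq:
  assumes path: "rel_trace_diagonal U" "std_path (c # U)" "set (c # U) = insert b D" "c \<noteq> b"
    and diagram: "young D" "b \<in> addable D" "b' \<in> addable D"
  shows "rel_trace b b' F (c # U) = (if b = b' then content_ratio D (HD b) * F (c # U) else 0)"
proof -
  have "c \<in> corners (insert b D)" using std_path_hd_corner[OF path(2)] path(3) by simp
  note corner = corners_insert_addableD[OF diagram(1,2) this path(4)]
  have "c \<notin> set U" using path(2) addable_notin by auto
  then have "set U = insert b D - {c}" by (simp flip: path(3))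
  then have set_U: "set U = insert b (D - {c})" using path(4) by (simp add: insert_Diff_if)
  note remove = young_remove_corner[OF corner(1)]
    addable_after_removing_corner[OF diagram(1,2) corner] addable_remove_corner[OF diagram(1) corner(1)]
  have "rel_trace b c G U = 0" for G
    using rel_trace_diagonalD[OF path(1) set_U remove] path(4) by simp
  then have "rel_trace b b' F (c # U) = - (\<alpha> * \<beta>) * inv_offdiag c b *
      (if b = b' then inv_offdiag b' c * (content_ratio (D - {c}) (HD b) * F (c # U)) else 0)"
    using path(2) rel_trace_hd_neq[OF _ path(4)]
      inv_offdiag_mult_rel_trace[OF path(1) diagram(1,3) corner(1) set_U remove(2)] by simp
  also have "\<dots> = (if b = b' then (- (\<alpha> * \<beta>) * (inv_offdiag c b * inv_offdiag b c)) *
      content_ratio (D - {c}) (HD b) * F (c # U) else 0)"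
    by simp
  finally show ?thesis
    unfolding
      inv_offdiag_mult[OF corner(2) HD_corner_neq_addable[OF diagram(1,2) corner(1), symmetric]]
      content_ratio_remove_distant_corner[OF diagram(1,2) corner] .
qed

lemma std_path_rel_trace_diagonal: "std_path L \<Longrightarrow> rel_trace_diagonal L"
proof (induction L)
  case (Cons c U)
  then have tail: "rel_trace_diagonal U" "std_path U" "c \<notin> set U" using addable_notin by auto
  show ?case
    unfolding rel_trace_diagonal_def
  proof (intro allI impI)
    fix D b b' F
    assume diagram: "set (c # U) = insert b D" "young D" "b \<in> addable D" "b' \<in> addable D"
    show "rel_trace b b' F (c # U) = (if b = b' then content_ratio D (HD b) * F (c # U) else 0)"
    proof (cases "c = b")
      case True
      then have "set U = D" using diagram(1) tail(3) addable_notin[OF diagram(3)] by auto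
      then show ?thesis
        using rel_trace_diagonal_hd_eq[OF tail(1,2), of b b' F] diagram(3,4) True by simp
    next
      case False
      then show ?thesis
        using rel_trace_diagonal_hd_neq[OF tail(1) Cons.prems diagram(1) _ diagram(2-4)] by simp
    qed
  qed
qed (simp add: rel_trace_diagonal_def)

end

section \<open>Fillings\<close>

definition convex_boxes :: "box set \<Rightarrow> bool" where
  "convex_boxes D \<longleftrightarrow> (\<forall>x\<in>D. \<forall>z\<in>D. \<forall>y. x \<le> y \<longrightarrow> y \<le> z \<longrightarrow> y \<in> D)"

lemma convex_boxesD: "convex_boxes D \<Longrightarrow> x \<in> D \<Longrightarrow> z \<in> D \<Longrightarrow> x \<le> y \<Longrightarrow> y \<le> z \<Longrightarrow> y \<in> D"
  unfolding convex_boxes_def by blast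

lemma convex_boxes_diff:
  assumes "young D" "young E"
  shows "convex_boxes (D - E)"
  unfolding convex_boxes_def
proof (intro ballI allI impI)
  fix x y z assume xyz: "x \<in> D - E" "z \<in> D - E" "x \<le> y" "y \<le> z"
  have x_ge: "(1, 1) \<le> x" using young_ge_1[OF assms(1)] xyz(1) by blast
  then have "(1, 1) \<le> y" using xyz(3) by (rule order_trans)
  then show "y \<in> D - E"
    using x_ge xyz young_downward[OF assms(1), of z y] young_downward[OF assms(2), of y x] by blast
qed

lemma convex_boxes_young: "young D \<Longrightarrow> convex_boxes D"
  using convex_boxes_diff[OF _ young_empty] by simp

lemma monotone_on_iff_lines:
  assumes "convex_boxes D" "transp R"
  shows "(\<forall>(i, j)\<in>D. \<forall>(i', j')\<in>D. i = i' \<and> j < j' \<or> j = j' \<and> i < i' \<longrightarrow> R (T (i, j)) (T (i', j')))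
    \<longleftrightarrow> monotone_on D (<) R T" (is "?lines \<longleftrightarrow> _")
proof
  assume ?lines
  then have line: "R (T (i, j)) (T (i', j'))"
    if "(i, j) \<in> D" "(i', j') \<in> D" "i = i' \<and> j < j' \<or> j = j' \<and> i < i'" for i j i' j'
    using that by fastforce
  show "monotone_on D (<) R T"
  proof (rule monotone_onI)
    fix x y assume xy: "x \<in> D" "y \<in> D" "x < y"
    obtain i j k l where coords: "x = (i, j)" "y = (k, l)" by (metis surj_pair)
    have weak: "i \<le> k" "j \<le> l" and strict: "i < k \<or> j < l"
      using xy(3) by (auto simp: coords less_prod_def)
    have bend: "(i, l) \<in> D" using convex_boxesD[OF assms(1) xy(1,2)] weak by (simp add: coords)
    show "R (T x) (T y)"
    proof (cases "i < k \<and> j < l")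
      case True
      then show ?thesis
        using line[of i j i l] line[of i l k l] bend xy(1,2) transpD[OF assms(2)]
        unfolding coords by blast
    next
      case False
      then show ?thesis using line[of i j k l] weak strict xy(1,2) unfolding coords by auto
    qed
  qed
next
  assume "monotone_on D (<) R T"
  then show ?lines by (auto simp: monotone_on_def less_prod_def)
qed

lemma rc_incr_iff: "convex_boxes D \<Longrightarrow> rc_incr T D \<longleftrightarrow> strict_mono_on D T"
  unfolding rc_incr_def by (rule monotone_on_iff_lines) simp_all

lemma rc_decr_iff: "convex_boxes D \<Longrightarrow> rc_decr T D \<longleftrightarrow> strict_antimono_on D T"
  unfolding rc_decr_def by (rule monotone_on_iff_lines) (simp_all add: transp_on_def)

definition filling :: "(nat \<Rightarrow> nat \<Rightarrow> bool) \<Rightarrow> tab \<Rightarrow> bool" where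
  "filling R T \<longleftrightarrow> convex_boxes (shape T) \<and> inj_on T (shape T) \<and> monotone_on (shape T) (<) R T"

abbreviation "standard \<equiv> filling (<)"
abbreviation "antistandard \<equiv> filling (\<lambda>x y. y < x)"

lemma pos_eq:
  assumes "filling R T" "T b = a" "a \<noteq> 0"
  shows "pos T a = b"
  unfolding pos_def
proof (rule the_equality)
  fix x assume "T x = a"
  then have "x \<in> shape T" "b \<in> shape T" "T x = T b" using assms by (auto simp: shape_def)
  then show "x = b" using assms(1) by (simp add: filling_def inj_on_def)
qed (rule assms(2))

lemma pos_vals:
  assumes "filling R T" "a \<in> vals T"
  shows "T (pos T a) = a" "pos T a \<in> shape T"
proof -
  obtain b where preimage: "b \<in> shape T" "T b = a" using assms(2) by (auto simp: vals_def)
  then have "pos T a = b" using assms(1) by (intro pos_eq) (auto simp: shape_def)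
  then show "T (pos T a) = a" "pos T a \<in> shape T" using preimage by auto
qed

lemma in_vals_iff: "a \<noteq> 0 \<Longrightarrow> a \<in> vals T \<longleftrightarrow> (\<exists>b. T b = a)"
  unfolding vals_def shape_def by blast

lemma filling_less: "filling R T \<Longrightarrow> x \<in> shape T \<Longrightarrow> y \<in> shape T \<Longrightarrow> x < y \<Longrightarrow> R (T x) (T y)"
  by (simp add: filling_def monotone_on_def)

lemma filling_covers:
  assumes fill: "filling R T" and boxes: "x \<in> shape T" "y \<in> shape T" "x \<le> y \<or> y \<le> x"
    and consecutive: "asymp R" "R (T x) (T y)" "\<And>v. R (T x) v \<Longrightarrow> R v (T y) \<Longrightarrow> False"
  shows "covers y x"
proof (rule coversI)
  have "x \<noteq> y" "\<not> y < x"
    using filling_less[OF fill boxes(2,1)] consecutive(1,2) by (auto dest: asympD)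
  then show "x < y" using boxes(3) by (auto simp: order_le_less)
next
  fix z assume between: "x < z" "z < y"
  then have "z \<in> shape T"
    using fill boxes(1,2) convex_boxesD[of "shape T" x y z] by (simp add: filling_def)
  then show False using filling_less[OF fill] boxes(1,2) between consecutive(3) by blast
qed

lemma shape_fun_upd: "v \<noteq> 0 \<Longrightarrow> shape (T(b := v)) = insert b (shape T)"
  and shape_fun_upd_0: "shape (T(b := 0)) = shape T - {b}"
  by (auto simp: shape_def)

lemma vals_fun_upd: "v \<noteq> 0 \<Longrightarrow> b \<notin> shape T \<Longrightarrow> vals (T(b := v)) = insert v (vals T)"
  by (auto simp: vals_def shape_fun_upd)

lemma vals_fun_upd_0: "filling R T \<Longrightarrow> b \<in> shape T \<Longrightarrow> vals (T(b := 0)) = vals T - {T b}"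
  by (auto simp: vals_def shape_fun_upd_0 filling_def inj_on_def)

lemma filling_fun_upd:
  assumes fill: "filling R T" and convex: "convex_boxes (insert b (shape T))"
    and outside: "b \<notin> shape T" "\<And>x. x \<in> shape T \<Longrightarrow> \<not> b < x"
    and extreme: "v \<noteq> 0" "v \<notin> vals T" "\<And>x. x \<in> shape T \<Longrightarrow> R (T x) v"
  shows "filling R (T(b := v))"
  unfolding filling_def shape_fun_upd[OF extreme(1)]
proof (intro conjI convex)
  have "T x \<noteq> v" if "x \<in> shape T" for x using that extreme(2) by (auto simp: vals_def)
  then show "inj_on (T(b := v)) (insert b (shape T))"
    using fill outside(1) by (auto simp: filling_def inj_on_def)
  show "monotone_on (insert b (shape T)) (<) R (T(b := v))"
    using outside extreme(3) filling_less[OF fill] by (auto intro!: monotone_onI)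
qed

lemma filling_fun_upd_0:
  assumes "filling R T" "convex_boxes (shape T - {b})"
  shows "filling R (T(b := 0))"
  using assms unfolding filling_def shape_fun_upd_0 by (auto simp: monotone_on_def inj_on_def)

lemma filling_move:
  assumes fill: "filling R T" "c \<in> shape T" "convex_boxes (shape T - {c})"
    and target: "b \<notin> shape T - {c}" "convex_boxes (insert b (shape T - {c}))"
      "\<And>x. x \<in> shape T - {c} \<Longrightarrow> \<not> b < x"
    and last: "\<And>x. x \<in> shape T - {c} \<Longrightarrow> R (T x) (T c)"
  shows "filling R (T(c := 0, b := T c))"
    and "shape (T(c := 0, b := T c)) = insert b (shape T - {c})"
    and "vals (T(c := 0, b := T c)) = vals T"
proof -
  let ?T = "T(c := 0)"
  have nonzero: "T c \<noteq> 0" and moved: "T c \<in> vals T"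
    using fill(2) by (auto simp: shape_def vals_def)
  have shape: "shape ?T = shape T - {c}" by (rule shape_fun_upd_0)
  have vals: "vals ?T = vals T - {T c}" using vals_fun_upd_0[OF fill(1,2)] .
  show "filling R (?T(b := T c))"
  proof (rule filling_fun_upd[OF filling_fun_upd_0[OF fill(1,3)]], unfold shape vals)
    show "R (?T x) (T c)" if "x \<in> shape T - {c}" for x using last[OF that] that by simp
  qed (use target nonzero in blast)+
  show "shape (?T(b := T c)) = insert b (shape T - {c})"
    using shape_fun_upd[OF nonzero] shape by simp
  show "vals (?T(b := T c)) = vals T"
    using vals_fun_upd[OF nonzero, of b ?T] target(1) moved unfolding shape vals
    by (metis insert_Diff)
qed

lemma standard_pos_1:
  assumes "standard T" "young (shape T)" "1 \<in> vals T"
  shows "pos T 1 = (1, 1)"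
proof (rule ccontr)
  note pos = pos_vals[OF assms(1,3)]
  have pos_ge: "(1, 1) \<le> pos T 1" using young_ge_1[OF assms(2) pos(2)] .
  then have in_shape: "(1, 1) \<in> shape T" using young_downward[OF assms(2) pos(2) order_refl] by simp
  assume "pos T 1 \<noteq> (1, 1)"
  then have "T (1, 1) < 1"
    using filling_less[OF assms(1) in_shape pos(2)] pos_ge pos(1) by (simp add: order_less_le)
  then show False using in_shape by (simp add: shape_def)
qed

section \<open>Consecutive entries\<close>

definition same_row :: "nat \<Rightarrow> tab \<Rightarrow> bool" where
  "same_row j T \<longleftrightarrow> j \<in> vals T \<and> j + 1 \<in> vals T \<and> fst (pos T j) = fst (pos T (j + 1))"

definition same_col :: "nat \<Rightarrow> tab \<Rightarrow> bool" where
  "same_col j T \<longleftrightarrow> j \<in> vals T \<and> j + 1 \<in> vals T \<and> snd (pos T j) = snd (pos T (j + 1))"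

lemma standard_consecutive_HD:
  assumes "standard T" "j \<in> vals T" "j + 1 \<in> vals T"
  shows "HD (pos T (j + 1)) \<noteq> HD (pos T j)"
    and "same_row j T \<Longrightarrow> HD (pos T (j + 1)) = HD (pos T j) - 1"
    and "same_col j T \<Longrightarrow> HD (pos T (j + 1)) = HD (pos T j) + 1"
proof -
  have "covers (pos T (j + 1)) (pos T j)" if "pos T j \<le> pos T (j + 1) \<or> pos T (j + 1) \<le> pos T j"
    using that pos_vals[OF assms(1,2)] pos_vals[OF assms(1,3)]
    by (intro filling_covers[OF assms(1)]) (auto intro: asympI)
  note HD = HD_if_comparable_covers[OF this]
  show "HD (pos T (j + 1)) \<noteq> HD (pos T j)"
    and "same_row j T \<Longrightarrow> HD (pos T (j + 1)) = HD (pos T j) - 1"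
    and "same_col j T \<Longrightarrow> HD (pos T (j + 1)) = HD (pos T j) + 1"
    using HD unfolding same_row_def same_col_def by blast+
qed

lemma antistandard_consecutive_HD:
  assumes "antistandard T" "j \<in> vals T" "j + 1 \<in> vals T"
  shows "HD (pos T j) \<noteq> HD (pos T (j + 1))"
    and "same_row j T \<Longrightarrow> HD (pos T j) = HD (pos T (j + 1)) - 1"
    and "same_col j T \<Longrightarrow> HD (pos T j) = HD (pos T (j + 1)) + 1"
proof -
  have "covers (pos T j) (pos T (j + 1))" if "pos T (j + 1) \<le> pos T j \<or> pos T j \<le> pos T (j + 1)"
    using that pos_vals[OF assms(1,2)] pos_vals[OF assms(1,3)]
    by (intro filling_covers[OF assms(1)]) (auto intro: asympI)
  note HD = HD_if_comparable_covers[OF this]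
  show "HD (pos T j) \<noteq> HD (pos T (j + 1))"
    and "same_row j T \<Longrightarrow> HD (pos T j) = HD (pos T (j + 1)) - 1"
    and "same_col j T \<Longrightarrow> HD (pos T j) = HD (pos T (j + 1)) + 1"
    using HD unfolding same_row_def same_col_def by metis+
qed

lemma swapv_eq: "swapv a b T = transpose a b \<circ> T"
  by (auto simp: swapv_def transpose_def)

lemma swapv_swapv: "swapv a b (swapv a b T) = T"
  by (simp add: swapv_eq fun_eq_iff)

lemma shape_swapv: "a \<noteq> 0 \<Longrightarrow> b \<noteq> 0 \<Longrightarrow> shape (swapv a b T) = shape T"
  by (auto simp: shape_def swapv_def)

lemma vals_swapv: "a \<noteq> 0 \<Longrightarrow> b \<noteq> 0 \<Longrightarrow> vals (swapv a b T) = transpose a b ` vals T"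
  unfolding vals_def shape_swapv by (simp add: swapv_eq image_comp)

lemma in_vals_swapv: "a \<noteq> 0 \<Longrightarrow> b \<noteq> 0 \<Longrightarrow> k \<in> vals (swapv a b T) \<longleftrightarrow> transpose a b k \<in> vals T"
  unfolding vals_swapv by (metis imageE image_eqI transpose_involutory)

lemma pos_swapv: "pos (swapv a b T) k = pos T (transpose a b k)"
  unfolding pos_def swapv_eq comp_def by (metis transpose_involutory)

lemma same_row_swapv: "j \<noteq> 0 \<Longrightarrow> same_row j (swapv j (j + 1) T) \<longleftrightarrow> same_row j T"
  and same_col_swapv: "j \<noteq> 0 \<Longrightarrow> same_col j (swapv j (j + 1) T) \<longleftrightarrow> same_col j T"
  by (auto simp: same_row_def same_col_def in_vals_swapv pos_swapv)

lemma filling_swapv: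
  assumes fill: "filling R T" and order: "R = (<) \<or> R = (\<lambda>x y. y < x)"
    and not_aligned: "j \<noteq> 0" "\<not> same_row j T" "\<not> same_col j T"
  shows "filling R (swapv j (j + 1) T)"
proof -
  have shape: "shape (swapv j (j + 1) T) = shape T" using not_aligned(1) by (simp add: shape_swapv)
  have "R (swapv j (j + 1) T x) (swapv j (j + 1) T y)"
    if boxes: "x \<in> shape T" "y \<in> shape T" "x < y" for x y
  proof -
    have "{T x, T y} \<noteq> {j, j + 1}"
    proof
      assume vals: "{T x, T y} = {j, j + 1}"
      then have "covers y x"
        using order filling_less[OF fill boxes] boxes
        by (intro filling_covers[OF fill]) (auto intro: asympI simp: doubleton_eq_iff)
      then have "aligned x y" by (rule covers_aligned)
      moreover have "pos T (T z) = z" "T z \<in> vals T" if "z \<in> shape T" for z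
        using that pos_eq[OF fill refl] by (simp_all add: shape_def vals_def)
      ultimately have "aligned (pos T j) (pos T (j + 1))" "j \<in> vals T" "j + 1 \<in> vals T"
        using vals boxes(1,2) aligned_commute unfolding doubleton_eq_iff by metis+
      then show False using not_aligned(2,3) by (auto simp: same_row_def same_col_def aligned_def)
    qed
    then show ?thesis
      using order filling_less[OF fill boxes] by (auto simp: swapv_def)
  qed
  moreover have "inj_on (swapv j (j + 1) T) (shape T)"
    using fill unfolding filling_def swapv_eq
    by (intro comp_inj_on inj_on_subset[OF bij_is_inj[OF bij_transpose]]) auto
  ultimately show ?thesis
    using fill unfolding filling_def shape by (auto intro!: monotone_onI)
qed

section \<open>Tableaux as paths\<close>

fun path_tab :: "box list \<Rightarrow> tab" where
  "path_tab [] = (\<lambda>_. 0)"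
| "path_tab (b # L) = (path_tab L)(b := Suc (length L))"

lemma path_tab_le: "path_tab L b \<le> length L"
  by (induction L) (auto simp: le_Suc_eq)

lemma shape_path_tab: "shape (path_tab L) = set L"
  by (induction L) (simp_all add: shape_fun_upd shape_def[of "\<lambda>_. 0"] del: fun_upd_apply)

lemma vals_path_tab: "distinct L \<Longrightarrow> vals (path_tab L) = {1..length L}"
proof (induction L)
  case (Cons b L)
  then show ?case
    by (simp add: vals_fun_upd shape_path_tab atLeastAtMostSuc_conv del: fun_upd_apply)
qed (simp add: vals_def shape_def)

lemma standard_path_tab: "std_path L \<Longrightarrow> standard (path_tab L)"
proof (induction L)
  case Nil
  then show ?case by (simp add: filling_def shape_def convex_boxes_def)
next
  case (Cons b L)
  then have tail: "std_path L" "b \<in> addable (set L)" by auto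
  show ?case
    unfolding path_tab.simps
  proof (rule filling_fun_upd[OF Cons.IH[OF tail(1)]])
    show "convex_boxes (insert b (shape (path_tab L)))"
      using convex_boxes_young[OF young_insert_addable[OF tail(2)]] by (simp add: shape_path_tab)
    show "b \<notin> shape (path_tab L)" using addable_notin[OF tail(2)] by (simp add: shape_path_tab)
    show "\<not> b < x" if "x \<in> shape (path_tab L)" for x
      using addable_not_below[OF std_path_young[OF tail(1)] tail(2)] that
      unfolding shape_path_tab by (blast intro: less_imp_le)
    show "Suc (length L) \<notin> vals (path_tab L)"
      using vals_path_tab[OF std_path_distinct[OF tail(1)]] by simp
  qed (use path_tab_le[of L] in \<open>auto simp: less_Suc_eq_le\<close>)
qed

lemma standard_tableau_path:
  assumes "standard W" "young (shape W)" "vals W = {1..n}"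
  shows "\<exists>L. std_path L \<and> path_tab L = W \<and> length L = n"
  using assms
proof (induction n arbitrary: W)
  case 0
  then have "shape W = {}" by (simp add: vals_def)
  then have "W = path_tab []" by (auto simp: shape_def fun_eq_iff)
  then show ?case by (intro exI[of _ "[]"]) auto
next
  case (Suc n)
  note tableau = Suc.prems
  define b where "b = pos W (Suc n)"
  have largest: "W b = Suc n" "b \<in> shape W"
    using pos_vals[OF tableau(1)] tableau(3) by (auto simp: b_def)
  have "x \<notin> shape W" if "b < x" for x
  proof
    assume x_in: "x \<in> shape W"
    then have "W x \<in> {1..Suc n}" using tableau(3) by (auto simp: vals_def)
    then show False using filling_less[OF tableau(1) largest(2) x_in that] largest(1) by simp
  qed
  then have corner: "b \<in> corners (shape W)"
    using largest(2) by (simp add: corners_iff_maximal[OF tableau(2)])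
  have shape: "shape (W(b := 0)) = shape W - {b}" by (rule shape_fun_upd_0)
  have "standard (W(b := 0))"
    by (intro filling_fun_upd_0[OF tableau(1)] convex_boxes_young young_remove_corner[OF corner])
  moreover have "vals (W(b := 0)) = {1..n}"
    unfolding vals_fun_upd_0[OF tableau(1) largest(2)] tableau(3) largest(1) by auto
  ultimately have "\<exists>L. std_path L \<and> path_tab L = W(b := 0) \<and> length L = n"
    using young_remove_corner[OF corner] by (intro Suc.IH) (simp_all only: shape)
  then obtain L where path: "std_path L" "path_tab L = W(b := 0)" "length L = n" by blast
  have "set L = shape W - {b}" using shape path(2) shape_path_tab by metis
  then have "std_path (b # L)" using path(1) addable_remove_corner[OF tableau(2) corner] by simp
  moreover have "path_tab (b # L) = W" using path largest(1) by auto
  ultimately show ?case using path(3) by (intro exI[of _ "b # L"]) auto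
qed

lemma pos_path_tab:
  assumes "std_path (xs @ b # ys)"
  shows "pos (path_tab (xs @ b # ys)) (Suc (length ys)) = b"
proof (rule pos_eq[OF standard_path_tab[OF assms]])
  show "path_tab (xs @ b # ys) b = Suc (length ys)"
    using std_path_distinct[OF assms] by (induction xs) auto
qed simp

lemma path_tab_swap:
  assumes "c \<noteq> d"
  shows "path_tab (xs @ d # c # ys) =
    swapv (Suc (length ys)) (Suc (length ys) + 1) (path_tab (xs @ c # d # ys))"
proof (induction xs)
  case Nil
  have "path_tab ys x \<noteq> Suc (length ys)" "path_tab ys x \<noteq> Suc (Suc (length ys))" for x
    using path_tab_le[of ys x] by auto
  then show ?case using assms by (auto simp: swapv_def fun_eq_iff)
qed (auto simp: swapv_def fun_eq_iff)

lemma young_subset_square: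
  assumes "young D"
  shows "D \<subseteq> {1..card D} \<times> {1..card D}"
proof (rule subrelI)
  fix i j assume in_D: "(i, j) \<in> D"
  have ge_1: "1 \<le> i" "1 \<le> j" using young_ge_1[OF assms in_D] by auto
  then have "{1..i} \<times> {j} \<subseteq> D" "{i} \<times> {1..j} \<subseteq> D" using young_downward[OF assms in_D] by auto
  then have "i \<le> card D" "j \<le> card D"
    using card_mono[OF young_finite[OF assms], of "{1..i} \<times> {j}"]
      card_mono[OF young_finite[OF assms], of "{i} \<times> {1..j}"] by simp_all
  then show "(i, j) \<in> {1..card D} \<times> {1..card D}" using ge_1 by simp
qed

lemma finite_tabs:
  assumes "finite Q"
  shows "finite {T. shape T \<subseteq> Q \<and> vals T \<subseteq> {..N}}"
proof (rule finite_subset)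
  show "{T. shape T \<subseteq> Q \<and> vals T \<subseteq> {..N}} \<subseteq> {T. \<forall>x. (x \<in> Q \<longrightarrow> T x \<in> {..N}) \<and> (x \<notin> Q \<longrightarrow> T x = 0)}"
  proof (intro subsetI CollectI allI)
    fix T x assume "T \<in> {T. shape T \<subseteq> Q \<and> vals T \<subseteq> {..N}}"
    then show "(x \<in> Q \<longrightarrow> T x \<in> {..N}) \<and> (x \<notin> Q \<longrightarrow> T x = 0)"
      by (cases "T x = 0") (auto simp: shape_def vals_def)
  qed
qed (rule finite_set_of_finite_funs[OF assms finite_atMost])

section \<open>Standard triples\<close>

locale bipartition =
  fixes m n :: nat and lam' lam :: "box set"
  assumes young_lam': "young lam'" and young_lam: "young lam"
begin

abbreviation std :: "triple \<Rightarrow> bool" where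
  "std \<equiv> std_triple m n lam' lam"

lemma std_iff:
  "std (B, S, W) \<longleftrightarrow>
    young (shape W) \<and> lam \<subseteq> shape W \<and> card (shape W - lam) = m - card lam' \<and>
    standard W \<and> vals W = {1..n} \<and> shape B = lam' \<and> standard B \<and>
    shape S = shape W - lam \<and> antistandard S \<and>
    vals B \<inter> vals S = {} \<and> vals B \<union> vals S = {1..m}"
  using convex_boxes_young[of "shape W"] convex_boxes_young[OF young_lam']
    convex_boxes_diff[OF _ young_lam, of "shape W"]
  unfolding std_triple_def prod.case filling_def bij_betw_def vals_def
  by (auto simp: rc_incr_iff rc_decr_iff)

lemma stdD:
  assumes "std (B, S, W)"
  shows std_young: "young (shape W)"
    and std_standard_W: "standard W" and std_vals_W: "vals W = {1..n}"
    and std_shape_B: "shape B = lam'" and std_standard_B: "standard B"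
    and std_shape_S: "shape S = shape W - lam" and std_antistandard_S: "antistandard S"
    and std_vals_disjoint: "vals B \<inter> vals S = {}" and std_vals_BS: "vals B \<union> vals S = {1..m}"
  using assms unfolding std_iff by blast+

lemma std_path_exists: "std (B, S, W) \<Longrightarrow> \<exists>L. std_path L \<and> path_tab L = W \<and> length L = n"
  using standard_tableau_path stdD by blast

lemma std_path_length: "std (B, S, path_tab L) \<Longrightarrow> std_path L \<Longrightarrow> length L = n"
  using std_vals_W vals_path_tab[OF std_path_distinct] by (metis card_atLeastAtMost diff_Suc_1)

lemma std_rearrange_path:
  assumes "std (B, S, path_tab L)" "std_path L" "std_path V" "set V = set L"
  shows "std (B, S, path_tab V)"
proof -
  have "length V = n"
    using std_path_length[OF assms(1,2)] assms(2-4) std_path_distinct distinct_card by metis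
  then show ?thesis
    using assms(1,4) standard_path_tab[OF assms(3)] vals_path_tab[OF std_path_distinct[OF assms(3)]]
    unfolding std_iff shape_path_tab by simp
qed

lemma std_swap_W:
  assumes "std (B, S, W)" "1 \<le> k" "k < n" "\<not> same_row k W" "\<not> same_col k W"
  shows "std (B, S, swapv k (k + 1) W)"
  using assms filling_swapv[OF std_standard_W[OF assms(1)], of k]
  unfolding std_iff by (simp add: shape_swapv vals_swapv)

lemma std_swap_BS:
  assumes "std (B, S, W)" "1 \<le> j" "j < m"
    and "\<not> same_row j B" "\<not> same_col j B" "\<not> same_row j S" "\<not> same_col j S"
  shows "std (swapv j (j + 1) B, swapv j (j + 1) S, W)"
proof -
  have "transpose j (j + 1) ` vals B \<inter> transpose j (j + 1) ` vals S = {}"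
    using std_vals_disjoint[OF assms(1)] by (auto dest: transpose_eq_imp_eq)
  moreover have "transpose j (j + 1) ` vals B \<union> transpose j (j + 1) ` vals S = {1..m}"
    using std_vals_BS[OF assms(1)] assms(2,3) by (simp flip: image_Un)
  ultimately show ?thesis
    using assms filling_swapv[OF std_standard_B[OF assms(1)], of j]
      filling_swapv[OF std_antistandard_S[OF assms(1)], of j]
    unfolding std_iff by (simp add: shape_swapv vals_swapv)
qed

lemma std_corner_1:
  assumes "std (B, S, W)" "S b = 1"
  shows "b \<in> corners (shape W)"
proof -
  note antistd = std_antistandard_S[OF assms(1)] and shape_S = std_shape_S[OF assms(1)]
  have b_in: "b \<in> shape S" using assms(2) by (simp add: shape_def)
  have "x \<notin> shape W" if "b < x" for x
  proof
    assume x: "x \<in> shape W"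
    have "b \<notin> lam" "(1, 1) \<le> b"
      using b_in shape_S young_ge_1[OF std_young[OF assms(1)]] by blast+
    then have "x \<notin> lam" using young_downward[OF young_lam] less_imp_le[OF that] by blast
    then have x: "x \<in> shape S" using x shape_S by simp
    then have "S x < 1" using filling_less[OF antistd b_in x that] assms(2) by simp
    then show False using x by (simp add: shape_def)
  qed
  then show ?thesis
    using b_in shape_S by (simp add: corners_iff_maximal[OF std_young[OF assms(1)]])
qed

lemma std_move_box_1:
  assumes "std (B, S, path_tab (c # U))" "std_path (c # U)" "S c = 1" "b \<in> addable (set U)"
  shows "std (B, S(c := 0, b := 1), path_tab (b # U))"
proof -
  note antistd = std_antistandard_S[OF assms(1)]
  have tail: "young (set U)" "c \<notin> set U" using assms(2) std_path_young addable_notin by auto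
  have new_box: "b \<notin> set U" "std_path (b # U)" using assms(2,4) addable_notin by auto
  have c_in: "c \<in> shape S" using assms(3) by (simp add: shape_def)
  have shape_S: "shape S = insert c (set U) - lam" and lam: "lam \<subseteq> set U" and c_notin_lam: "c \<notin> lam"
    and card: "card (insert c (set U) - lam) = m - card lam'"
    using assms(1) c_in unfolding std_iff shape_path_tab by auto
  have skew: "shape S - {c} = set U - lam" "insert b (set U - lam) = insert b (set U) - lam"
      "insert c (set U - lam) = insert c (set U) - lam"
    using shape_S tail(2) new_box(1) lam c_notin_lam by blast+
  have "1 < S x" if "x \<in> shape S - {c}" for x
  proof -
    have "S x \<noteq> 0" using that by (simp add: shape_def)
    moreover have "S x \<noteq> S c"
      using that antistd c_in unfolding filling_def by (metis DiffD1 DiffD2 inj_onD insertI1)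
    ultimately show ?thesis using assms(3) by simp
  qed
  note move = filling_move[OF antistd c_in, of b, unfolded skew assms(3),
      OF convex_boxes_diff[OF tail(1) young_lam] _
        convex_boxes_diff[OF young_insert_addable[OF assms(4)] young_lam] _ this[unfolded skew]]
  have "\<not> b < x" if "x \<in> set U - lam" for x
    using addable_not_below[OF tail(1) assms(4)] that by (blast intro: less_imp_le)
  moreover have "b \<notin> set U - lam" using new_box(1) by blast
  moreover have "card (insert b (set U) - lam) = m - card lam'"
    using card new_box(1) tail(2) young_finite[OF tail(1)] by (simp flip: skew(2,3))
  moreover have "length (c # U) = n" using std_path_length[OF assms(1,2)] .
  ultimately show ?thesis
    using assms(1,4) lam young_insert_addable[OF assms(4)] standard_path_tab[OF new_box(2)]
      vals_path_tab[OF std_path_distinct[OF new_box(2)]] move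
    unfolding std_iff shape_path_tab by auto
qed

lemma finite_Tset: "finite (Tset m n lam' lam)"
proof (rule finite_subset)
  let ?tabs = "{T. shape T \<subseteq> lam' \<union> {1..n} \<times> {1..n} \<and> vals T \<subseteq> {..m + n}}"
  show "Tset m n lam' lam \<subseteq> ?tabs \<times> ?tabs \<times> ?tabs"
  proof
    fix \<tau> assume "\<tau> \<in> Tset m n lam' lam"
    then obtain B S W where triple: "\<tau> = (B, S, W)" and std: "std (B, S, W)"
      by (cases \<tau>) (auto simp: Tset_def)
    have "card (shape W) = n"
      using card_image[of W "shape W"] std_standard_W[OF std] std_vals_W[OF std]
      by (simp add: filling_def vals_def)
    then have "shape W \<subseteq> {1..n} \<times> {1..n}" using young_subset_square[OF std_young[OF std]] by simp
    moreover have "k \<le> m" if "k \<in> vals B \<union> vals S" for k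
      using that unfolding std_vals_BS[OF std] by simp
    then have "vals B \<subseteq> {..m + n}" "vals S \<subseteq> {..m + n}" by fastforce+
    ultimately show "\<tau> \<in> ?tabs \<times> ?tabs \<times> ?tabs"
      using std_vals_W[OF std] std_shape_B[OF std] std_shape_S[OF std] by (auto simp: triple)
  qed
  show "finite (?tabs \<times> ?tabs \<times> ?tabs)"
    using young_finite[OF young_lam'] by (intro finite_cartesian_product finite_tabs) auto
qed

end

section \<open>Linear operators\<close>

definition linear_op :: "op \<Rightarrow> bool" where
  "linear_op X \<longleftrightarrow> (\<forall>a b v w. X (\<lambda>\<sigma>. a * v \<sigma> + b * w \<sigma>) = (\<lambda>\<sigma>. a * X v \<sigma> + b * X w \<sigma>))"

lemma linear_opD: "linear_op X \<Longrightarrow> X (\<lambda>\<sigma>. a * v \<sigma> + b * w \<sigma>) = (\<lambda>\<sigma>. a * X v \<sigma> + b * X w \<sigma>)"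
  by (simp add: linear_op_def)

lemma linear_op_scale: "linear_op X \<Longrightarrow> X (\<lambda>\<sigma>. a * v \<sigma>) = (\<lambda>\<sigma>. a * X v \<sigma>)"
  using linear_opD[of X a v 0 v] by simp

lemma linear_op_zero: "linear_op X \<Longrightarrow> X (\<lambda>\<sigma>. 0) = (\<lambda>\<sigma>. 0)"
  using linear_op_scale[of X 0 "\<lambda>_. 0"] by simp

lemma linear_op_sum:
  assumes "linear_op X" "finite A"
  shows "X (\<lambda>\<sigma>. \<Sum>x\<in>A. a x * v x \<sigma>) = (\<lambda>\<sigma>. \<Sum>x\<in>A. a x * X (v x) \<sigma>)"
  using assms(2)
proof (induction A)
  case empty
  show ?case using linear_op_zero[OF assms(1)] by simp
next
  case (insert x A)
  then show ?case
    using linear_opD[OF assms(1), of "a x" "v x" 1 "\<lambda>\<sigma>. \<Sum>x\<in>A. a x * v x \<sigma>"] by simp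
qed

lemma linear_op_id: "linear_op id"
  by (simp add: linear_op_def)

lemma linear_op_comp: "linear_op X \<Longrightarrow> linear_op Y \<Longrightarrow> linear_op (X \<circ> Y)"
  by (simp add: linear_op_def)

lemma linear_op_divide: "linear_op X \<Longrightarrow> linear_op (\<lambda>v \<sigma>. X v \<sigma> / c)"
  by (simp add: linear_op_def add_divide_distrib)

lemma linear_op_lin: "linear_op (lin T X)"
  by (simp add: linear_op_def lin_def sum_distrib_left sum.distrib distrib_right mult.assoc)

lemma lin_delta:
  assumes "finite T" "\<tau> \<in> T"
  shows "lin T X (delta \<tau>) = X \<tau>"
proof
  fix \<sigma>
  have "(\<Sum>t\<in>T. delta \<tau> t * X t \<sigma>) = (\<Sum>t\<in>T. if t = \<tau> then X t \<sigma> else 0)"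
    by (rule sum.cong) (auto simp: delta_def)
  then show "lin T X (delta \<tau>) \<sigma> = X \<tau> \<sigma>" using assms by (simp add: lin_def)
qed

section \<open>The seminormal representation\<close>

locale seminormal_rep = qwb P + bipartition m n lam' lam
  for P :: qwb_param and m n :: nat and lam' lam :: "box set" +
  assumes n_pos: "1 \<le> n"
begin

abbreviation "gen_h \<equiv> h_op P m n lam' lam"
abbreviation "gen_hinv \<equiv> hinv_op P m n lam' lam"
abbreviation "gen_g \<equiv> g_op P m n lam' lam"
abbreviation "gen_E \<equiv> E_op P m n lam' lam"
abbreviation "left_h \<equiv> Lh P m n lam' lam"
abbreviation "right_h \<equiv> Rh P m n lam' lam"
abbreviation "jm \<equiv> JM P m n lam' lam"
abbreviation "jm_Suc_n \<equiv> J_np1 P m n lam' lam"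
abbreviation "wt \<equiv> Wt P n"

lemma linear_op_gen: "linear_op (gen_h i)" "linear_op (gen_g i)" "linear_op gen_E"
  by (simp_all add: h_op_def g_op_def E_op_def linear_op_lin)

lemma linear_op_hinv: "linear_op (gen_hinv i)"
  using linear_op_gen(1)[of i] unfolding linear_op_def hinv_op_def
  by (auto simp: fun_eq_iff add_divide_distrib diff_divide_distrib algebra_simps)

lemma linear_op_left_h: "linear_op (left_h k)"
  by (induction k) (simp_all only: Lh.simps linear_op_id linear_op_comp linear_op_hinv)

lemma linear_op_right_h: "linear_op (right_h k)"
  by (induction k) (simp_all only: Rh.simps linear_op_id linear_op_comp linear_op_hinv)

lemma linear_op_jm_Suc_n: "linear_op jm_Suc_n"
proof -
  have "linear_op (left_h k \<circ> gen_E \<circ> right_h k)" for k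
    by (intro linear_op_comp linear_op_left_h linear_op_gen linear_op_right_h)
  from linear_opD[OF this] show ?thesis
    unfolding linear_op_def J_np1_def
    by (simp add: fun_eq_iff sum_distrib_left sum.distrib algebra_simps)
qed

lemma linear_op_jm: "linear_op (jm k)"
proof (induction k)
  case (Suc k)
  have "linear_op (\<lambda>v \<sigma>. X (jm k (X v)) \<sigma> / c)" if "linear_op X" for X c
    using linear_op_divide[OF linear_op_comp[OF linear_op_comp[OF that Suc.IH] that]] by simp
  then show ?case
    unfolding JM.simps using linear_op_id linear_op_gen linear_op_jm_Suc_n by presburger
qed (simp add: linear_op_def)

lemma gen_delta:
  assumes "std \<tau>"
  shows "gen_h i (delta \<tau>) = h_basis P n i \<tau>" "gen_g i (delta \<tau>) = g_basis P n i \<tau>"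
    "gen_E (delta \<tau>) = E_basis P n \<tau>"
proof -
  have "\<tau> \<in> Tset m n lam' lam" using assms by (simp add: Tset_def)
  then show "gen_h i (delta \<tau>) = h_basis P n i \<tau>" "gen_g i (delta \<tau>) = g_basis P n i \<tau>"
    "gen_E (delta \<tau>) = E_basis P n \<tau>"
    unfolding h_op_def g_op_def E_op_def by (simp_all only: lin_delta[OF finite_Tset])
qed

section \<open>Weights\<close>

lemma Wt_unprimed: "k < n \<Longrightarrow> wt (B, S, W) k = q powi HD (pos W (k + 1))"
  by (simp add: Wt_def)

lemma Wt_primed:
  assumes "1 \<le> i"
  shows "wt (B, S, W) (n + i - 1) =
    (if i \<in> vals B then q powi HD (pos B i) else - \<theta> * q powi (- HD (pos S i)))"
proof -
  have "\<not> n + i - 1 < n" "n + i - 1 + 1 - n = i" using assms by auto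
  then show ?thesis by (simp only: Wt_def prod.case Let_def if_False)
qed

lemma Wt_swap_W:
  assumes "1 \<le> k" "k < n"
  shows "wt (B, S, swapv k (k + 1) W) (k - 1) = wt (B, S, W) k"
    and "wt (B, S, swapv k (k + 1) W) k = wt (B, S, W) (k - 1)"
  using assms by (simp_all add: Wt_unprimed pos_swapv)

lemma Wt_swap_BS:
  assumes "1 \<le> j"
  shows "wt (swapv j (j + 1) B, swapv j (j + 1) S, W) (n + j - 1) = wt (B, S, W) (n + j)"
    and "wt (swapv j (j + 1) B, swapv j (j + 1) S, W) (n + j) = wt (B, S, W) (n + j - 1)"
  using Wt_primed[OF assms] Wt_primed[of "j + 1"] assms
  by (simp_all add: in_vals_swapv pos_swapv)

definition adjacent_weights :: "bool \<Rightarrow> bool \<Rightarrow> complex \<Rightarrow> complex \<Rightarrow> bool" where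
  "adjacent_weights row col \<mu> \<nu> \<longleftrightarrow>
    \<mu> \<noteq> 0 \<and> \<nu> \<noteq> 0 \<and> \<mu> \<noteq> \<nu> \<and> (row \<longrightarrow> \<mu> / \<nu> = q) \<and> (col \<longrightarrow> \<mu> / \<nu> = 1 / q)"

lemma adjacent_weights_powi:
  assumes "a \<noteq> b" "row \<Longrightarrow> a = b + 1" "col \<Longrightarrow> a = b - 1" "c \<noteq> 0"
  shows "adjacent_weights row col (c * q powi a) (c * q powi b)"
  using assms by (auto simp: adjacent_weights_def power_int_minus_divide simp flip: power_int_diff)

lemma adjacent_weights_unprimed:
  assumes "std (B, S, W)" "1 \<le> k" "k < n"
  shows "adjacent_weights (same_row k W) (same_col k W) (wt (B, S, W) (k - 1)) (wt (B, S, W) k)"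
proof -
  have "k \<in> vals W" "k + 1 \<in> vals W" using std_vals_W[OF assms(1)] assms(2,3) by auto
  note HD = standard_consecutive_HD[OF std_standard_W[OF assms(1)] this]
  show ?thesis
    using adjacent_weights_powi[where c = 1 and a = "HD (pos W k)" and b = "HD (pos W (k + 1))"]
      HD assms(2,3) by (simp add: Wt_unprimed)
qed

lemma adjacent_weights_primed:
  assumes "std (B, S, W)" "1 \<le> j" "j < m"
  shows "adjacent_weights (same_row j B \<or> same_row j S) (same_col j B \<or> same_col j S)
    (wt (B, S, W) (n + j - 1)) (wt (B, S, W) (n + j))"
proof -
  note B = standard_consecutive_HD[OF std_standard_B[OF assms(1)], of j]
    and S = antistandard_consecutive_HD[OF std_antistandard_S[OF assms(1)], of j]
  have "j \<in> vals B \<union> vals S" "j + 1 \<in> vals B \<union> vals S"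
    unfolding std_vals_BS[OF assms(1)] using assms(2,3) by auto
  then have vals: "j \<in> vals B \<longleftrightarrow> j \<notin> vals S" "j + 1 \<in> vals B \<longleftrightarrow> j + 1 \<notin> vals S"
    using std_vals_disjoint[OF assms(1)] by blast+
  note wt = Wt_primed[OF assms(2)] Wt_primed[of "j + 1", simplified]
  consider "j \<in> vals B" "j + 1 \<in> vals B" | "j \<in> vals S" "j + 1 \<in> vals S"
    | "(j \<in> vals B) \<noteq> (j + 1 \<in> vals B)"
    using vals by blast
  then show ?thesis
  proof cases
    case 1
    then have "\<not> same_row j S" "\<not> same_col j S" using vals by (auto simp: same_row_def same_col_def)
    then show ?thesis
      unfolding wt using 1 B[OF 1]
        adjacent_weights_powi[where c = 1 and a = "HD (pos B j)" and b = "HD (pos B (j + 1))"]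
      by simp
  next
    case 2
    then have "\<not> same_row j B" "\<not> same_col j B" using vals by (auto simp: same_row_def same_col_def)
    then show ?thesis
      unfolding wt using 2 vals S[OF 2]
        adjacent_weights_powi[where c = "- \<theta>"
          and a = "- HD (pos S j)" and b = "- HD (pos S (j + 1))"]
      by simp
  next
    case 3
    then have "\<not> same_row j B" "\<not> same_col j B" "\<not> same_row j S" "\<not> same_col j S"
      using vals by (auto simp: same_row_def same_col_def)
    then show ?thesis
      unfolding wt using 3 q_powi_neq_theta q_powi_neq_theta[symmetric]
      by (auto simp: adjacent_weights_def)
  qed
qed

section \<open>Conjugation by a generator\<close>

definition seminormal :: "(complex \<Rightarrow> complex) \<Rightarrow> bool \<Rightarrow> complex \<Rightarrow> complex \<Rightarrow> vec \<Rightarrow> vec \<Rightarrow> vec" where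
  "seminormal f line \<mu> \<nu> t t' =
    (\<lambda>\<sigma>. gen_diag (\<mu> / \<nu>) * t \<sigma> + (if line then 0 else f (\<mu> / \<nu>)) * t' \<sigma>)"

lemma seminormal_line:
  assumes "adjacent_weights row col \<mu> \<nu>"
  shows "row \<Longrightarrow> seminormal f (row \<or> col) \<mu> \<nu> t t' = (\<lambda>\<sigma>. \<alpha> * t \<sigma>)"
    and "col \<Longrightarrow> seminormal f (row \<or> col) \<mu> \<nu> t t' = (\<lambda>\<sigma>. \<beta> * t \<sigma>)"
  using assms by (auto simp: seminormal_def adjacent_weights_def gen_diag_q gen_diag_inverse_q)

lemma gen_diag_weights:
  assumes "\<mu> \<noteq> 0" "\<nu> \<noteq> 0" "\<mu> \<noteq> \<nu>"
  shows "gen_diag (\<mu> / \<nu>) * \<mu> + gen_diag (\<nu> / \<mu>) * \<nu> = 0"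
    and "gen_diag (\<mu> / \<nu>) * gen_diag (\<mu> / \<nu>) * \<mu> - \<alpha> * \<beta> * Ffun P (\<mu> / \<nu>) * \<nu> = - (\<alpha> * \<beta>) * \<nu>"
proof -
  show "gen_diag (\<mu> / \<nu>) * \<mu> + gen_diag (\<nu> / \<mu>) * \<nu> = 0"
    unfolding gen_diag_def using assms by (simp add: divide_simps) algebra
  have nonzero: "\<nu> - \<mu> \<noteq> 0" using assms by simp
  have diag: "gen_diag (\<mu> / \<nu>) = \<alpha> * (1 - q) * \<nu> / (\<nu> - \<mu>)"
    unfolding gen_diag_def beta_eq using assms nonzero by (simp add: field_simps)
  have "Ffun P (\<mu> / \<nu>) = (\<nu> - q * \<mu>) * (q * \<nu> - \<mu>) / (q * (\<nu> - \<mu>)\<^sup>2)"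
    unfolding Ffun_eq using assms nonzero q_nonzero by (simp add: divide_simps) algebra
  then show "gen_diag (\<mu> / \<nu>) * gen_diag (\<mu> / \<nu>) * \<mu> - \<alpha> * \<beta> * Ffun P (\<mu> / \<nu>) * \<nu> = - (\<alpha> * \<beta>) * \<nu>"
    unfolding diag beta_eq using assms nonzero q_nonzero params_nonzero(1)
    by (simp add: divide_simps power2_eq_square) algebra
qed

lemma conj_seminormal:
  assumes linear: "linear_op H" "linear_op J" and weights: "adjacent_weights row col \<mu> \<nu>"
    and inverse: "\<And>x. x \<noteq> 0 \<Longrightarrow> x \<noteq> 1 \<Longrightarrow> f x * f (1 / x) = - (\<alpha> * \<beta>) * Ffun P x"
    and image: "H t = seminormal f (row \<or> col) \<mu> \<nu> t t'" "J t = (\<lambda>\<sigma>. \<mu> * t \<sigma>)"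
    and image': "\<not> (row \<or> col) \<Longrightarrow> H t' = seminormal f (row \<or> col) \<nu> \<mu> t' t"
      "\<not> (row \<or> col) \<Longrightarrow> J t' = (\<lambda>\<sigma>. \<nu> * t' \<sigma>)"
  shows "(\<lambda>\<sigma>. H (J (H t)) \<sigma> / - (\<alpha> * \<beta>)) = (\<lambda>\<sigma>. \<nu> * t \<sigma>)"
proof
  fix \<sigma>
  have distinct: "\<mu> \<noteq> 0" "\<nu> \<noteq> 0" "\<mu> \<noteq> \<nu>" using weights by (auto simp: adjacent_weights_def)
  define a a' where "a = gen_diag (\<mu> / \<nu>)" and "a' = gen_diag (\<nu> / \<mu>)"
  define e e' where "e = (if row \<or> col then 0 else f (\<mu> / \<nu>))"
    and "e' = (if row \<or> col then 0 else f (\<nu> / \<mu>))"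
  have H_t: "H t = (\<lambda>\<sigma>. a * t \<sigma> + e * t' \<sigma>)" by (simp add: image seminormal_def a_def e_def)
  have offdiag: "e * e' = - (\<alpha> * \<beta>) * Ffun P (\<mu> / \<nu>)"
    using inverse[of "\<mu> / \<nu>"] distinct weights
    by (auto simp: e_def e'_def adjacent_weights_def Ffun_q Ffun_inverse_q)
  have "J (H t) = (\<lambda>\<sigma>. a * \<mu> * t \<sigma> + e * \<nu> * t' \<sigma>)"
    using image' by (auto simp: H_t linear_opD[OF linear(2)] image e_def mult.assoc)
  then have "H (J (H t)) \<sigma> = a * \<mu> * H t \<sigma> + e * \<nu> * H t' \<sigma>"
    by (simp add: linear_opD[OF linear(1)])
  also have "e * H t' \<sigma> = e * (a' * t' \<sigma> + e' * t \<sigma>)"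
    using image' by (auto simp: e_def e'_def a'_def seminormal_def)
  then have "a * \<mu> * H t \<sigma> + e * \<nu> * H t' \<sigma> =
      (a * a * \<mu> + e * e' * \<nu>) * t \<sigma> + e * (a * \<mu> + a' * \<nu>) * t' \<sigma>"
    unfolding H_t by algebra
  also have "\<dots> = - (\<alpha> * \<beta>) * \<nu> * t \<sigma>"
    using gen_diag_weights[OF distinct] unfolding offdiag a_def[symmetric] a'_def[symmetric] by simp
  finally show "H (J (H t)) \<sigma> / - (\<alpha> * \<beta>) = \<nu> * t \<sigma>" by simp
qed

lemma gen_h_delta:
  assumes "std (B, S, W)" "1 \<le> k" "k < n"
  shows "gen_h (n - k) (delta (B, S, W)) = seminormal \<eta> (same_row k W \<or> same_col k W)
    (wt (B, S, W) (k - 1)) (wt (B, S, W) k) (delta (B, S, W)) (delta (B, S, swapv k (k + 1) W))"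
proof -
  have "k \<in> vals W" "k + 1 \<in> vals W" using std_vals_W[OF assms(1)] assms(2,3) by auto
  then have line: "same_row k W \<longleftrightarrow> fst (pos W k) = fst (pos W (k + 1))"
    "same_col k W \<longleftrightarrow> snd (pos W k) = snd (pos W (k + 1))"
    by (simp_all add: same_row_def same_col_def)
  have index: "n - (n - k) = k" using assms(3) by simp
  show ?thesis
    unfolding gen_delta[OF assms(1)] h_basis_def prod.case Let_def index line[symmetric]
    using seminormal_line[OF adjacent_weights_unprimed[OF assms]]
    by (simp add: seminormal_def gen_diag_def)
qed

lemma gen_g_delta:
  assumes "std (B, S, W)" "1 \<le> j" "j < m"
  shows "gen_g j (delta (B, S, W)) = seminormal \<zeta>
    ((same_row j B \<or> same_row j S) \<or> (same_col j B \<or> same_col j S))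
    (wt (B, S, W) (n + j - 1)) (wt (B, S, W) (n + j)) (delta (B, S, W))
    (delta (swapv j (j + 1) B, swapv j (j + 1) S, W))"
proof -
  define inB where "inB \<longleftrightarrow> j \<in> vals B \<and> j + 1 \<in> vals B"
  define inS where "inS \<longleftrightarrow> j \<in> vals S \<and> j + 1 \<in> vals S"
  define T where "T = (if inB then B else S)"
  have "\<not> (inB \<and> inS)" using std_vals_disjoint[OF assms(1)] by (auto simp: inB_def inS_def)
  moreover have "same_row j B \<longleftrightarrow> inB \<and> fst (pos B j) = fst (pos B (j + 1))"
      "same_row j S \<longleftrightarrow> inS \<and> fst (pos S j) = fst (pos S (j + 1))"
      "same_col j B \<longleftrightarrow> inB \<and> snd (pos B j) = snd (pos B (j + 1))"
      "same_col j S \<longleftrightarrow> inS \<and> snd (pos S j) = snd (pos S (j + 1))"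
    by (simp_all add: same_row_def same_col_def inB_def inS_def)
  ultimately have line:
    "(inB \<or> inS) \<and> fst (pos T j) = fst (pos T (j + 1)) \<longleftrightarrow> same_row j B \<or> same_row j S"
    "(inB \<or> inS) \<and> snd (pos T j) = snd (pos T (j + 1)) \<longleftrightarrow> same_col j B \<or> same_col j S"
    by (auto simp: T_def)
  show ?thesis
    unfolding gen_delta[OF assms(1)] g_basis_def prod.case Let_def
      inB_def[symmetric] inS_def[symmetric] T_def[symmetric] line
    using seminormal_line[OF adjacent_weights_primed[OF assms]]
    by (simp add: seminormal_def gen_diag_def)
qed

lemma jm_Suc_less_n:
  assumes k: "1 \<le> k" "k < n" and "std \<tau>"
    and IH: "\<And>\<tau>. std \<tau> \<Longrightarrow> jm k (delta \<tau>) = (\<lambda>\<sigma>. wt \<tau> (k - 1) * delta \<tau> \<sigma>)"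
  shows "jm (Suc k) (delta \<tau>) = (\<lambda>\<sigma>. wt \<tau> k * delta \<tau> \<sigma>)"
proof -
  obtain B S W where BSW: "\<tau> = (B, S, W)" by (metis surj_pair)
  note std = \<open>std \<tau>\<close>[unfolded BSW]
  have swap: "std (B, S, swapv k (k + 1) W)" if "\<not> (same_row k W \<or> same_col k W)"
    using std_swap_W[OF std k] that by blast
  note same_line = same_row_swapv[of k] same_col_swapv[of k]
  have "jm (Suc k) (delta \<tau>) =
      (\<lambda>\<sigma>. gen_h (n - k) (jm k (gen_h (n - k) (delta \<tau>))) \<sigma> / - (\<alpha> * \<beta>))"
    using k by simp
  also have "\<dots> = (\<lambda>\<sigma>. wt \<tau> k * delta \<tau> \<sigma>)"
    unfolding BSW
    using gen_h_delta[OF swap k] IH[OF swap] k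
    by (intro conj_seminormal[OF linear_op_gen(1) linear_op_jm adjacent_weights_unprimed[OF std k]
          eta_mult_inverse gen_h_delta[OF std k] IH[OF std]])
       (simp_all only: Wt_swap_W[OF k] swapv_swapv same_line not_one_le_zero simp_thms)
  finally show ?thesis .
qed

lemma jm_Suc_n_plus:
  assumes j: "1 \<le> j" "j < m" and "std \<tau>"
    and IH: "\<And>\<tau>. std \<tau> \<Longrightarrow> jm (n + j) (delta \<tau>) = (\<lambda>\<sigma>. wt \<tau> (n + j - 1) * delta \<tau> \<sigma>)"
  shows "jm (Suc (n + j)) (delta \<tau>) = (\<lambda>\<sigma>. wt \<tau> (n + j) * delta \<tau> \<sigma>)"
proof -
  obtain B S W where BSW: "\<tau> = (B, S, W)" by (metis surj_pair)
  note std = \<open>std \<tau>\<close>[unfolded BSW]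
  have swap: "std (swapv j (j + 1) B, swapv j (j + 1) S, W)"
    if "\<not> ((same_row j B \<or> same_row j S) \<or> (same_col j B \<or> same_col j S))"
    using std_swap_BS[OF std j] that by blast
  note same_line = same_row_swapv[of j] same_col_swapv[of j]
  have "jm (Suc (n + j)) (delta \<tau>) =
      (\<lambda>\<sigma>. gen_g j (jm (n + j) (gen_g j (delta \<tau>))) \<sigma> / - (\<alpha> * \<beta>))"
    using j n_pos by simp
  also have "\<dots> = (\<lambda>\<sigma>. wt \<tau> (n + j) * delta \<tau> \<sigma>)"
    unfolding BSW
    using gen_g_delta[OF swap j] IH[OF swap] j
    by (intro conj_seminormal[OF linear_op_gen(2) linear_op_jm adjacent_weights_primed[OF std j]
          zeta_mult_inverse gen_g_delta[OF std j] IH[OF std]])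
       (simp_all only: Wt_swap_BS[OF j(1)] swapv_swapv same_line not_one_le_zero simp_thms)
  finally show ?thesis .
qed

section \<open>The element of index \<open>n + 1\<close>\<close>

lemma hinv_dual_append:
  "hinv_dual (length xs) F (xs @ c # d # ys) =
    inv_diag c d * F (xs @ c # d # ys) + inv_offdiag c d * F (xs @ d # c # ys)"
  by (induction xs arbitrary: F) auto

lemma split_at_pair:
  assumes "Suc i < length L"
  obtains xs c d ys where "L = xs @ c # d # ys" "length xs = i"
proof -
  have "L = take i L @ L ! i # L ! Suc i # drop (Suc (Suc i)) L"
    using assms by (metis Cons_nth_drop_Suc Suc_lessD append_take_drop_id)
  then show thesis using that[of "take i L"] assms by simp
qed

lemma hinv_path:
  assumes "linear_op X" "std_path L" "std (B, S, path_tab L)" "Suc i < n"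
  shows "X (gen_hinv (Suc i) (delta (B, S, path_tab L))) \<sigma> =
    hinv_dual i (\<lambda>V. X (delta (B, S, path_tab V)) \<sigma>) L"
proof -
  have length_L: "length L = n" using std_path_length[OF assms(3,2)] .
  then obtain xs c d ys where L_eq: "L = xs @ c # d # ys" and length_xs: "length xs = i"
    using assms(4) split_at_pair by metis
  define k where "k = Suc (length ys)"
  let ?x = "q powi (HD d - HD c)"
  let ?t = "delta (B, S, path_tab L)" and ?t' = "delta (B, S, path_tab (xs @ d # c # ys))"
  have k_range: "1 \<le> k" "k < n" "n - k = Suc i"
    using length_L L_eq length_xs by (auto simp: k_def)
  have pos: "pos (path_tab L) k = d" "pos (path_tab L) (k + 1) = c"
    using pos_path_tab[of "xs @ [c]" d ys] pos_path_tab[of xs c "d # ys"] assms(2)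
    by (simp_all add: L_eq k_def)
  have distinct: "c \<noteq> d" using std_path_distinct[OF assms(2)] by (simp add: L_eq)
  have "k \<in> vals (path_tab L)" "k + 1 \<in> vals (path_tab L)"
    using std_vals_W[OF assms(3)] k_range by auto
  then have line: "same_row k (path_tab L) \<or> same_col k (path_tab L) \<longleftrightarrow> aligned c d"
    unfolding same_row_def same_col_def pos aligned_def by auto
  have ratio: "wt (B, S, path_tab L) (k - 1) / wt (B, S, path_tab L) k = ?x"
    using k_range pos by (simp add: Wt_unprimed power_int_diff)
  have "gen_h (Suc i) ?t = (\<lambda>\<sigma>. gen_diag ?x * ?t \<sigma> + (if aligned c d then 0 else \<eta> ?x) * ?t' \<sigma>)"
    using gen_h_delta[OF assms(3) k_range(1,2)] unfolding k_range(3) seminormal_def line ratio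
    by (simp add: path_tab_swap[OF distinct] L_eq k_def)
  then have "gen_hinv (Suc i) ?t = (\<lambda>\<sigma>. inv_diag c d * ?t \<sigma> + inv_offdiag c d * ?t' \<sigma>)"
    unfolding hinv_op_def inv_diag_def inv_offdiag_def
    by (simp add: fun_eq_iff divide_simps) (simp add: algebra_simps)
  then show ?thesis
    using hinv_dual_append[of xs] length_xs linear_opD[OF assms(1)] by (simp add: L_eq)
qed

lemma right_h_path:
  assumes "linear_op X" "std_path L" "std (B, S, path_tab L)" "k < n"
  shows "X (right_h k (delta (B, S, path_tab L))) \<sigma> =
    Rh_dual k (\<lambda>V. X (delta (B, S, path_tab V)) \<sigma>) L"
  using assms
proof (induction k arbitrary: L)
  case (Suc k)
  have "X (right_h (Suc k) (delta (B, S, path_tab L))) \<sigma> =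
      hinv_dual k (\<lambda>V. X (right_h k (delta (B, S, path_tab V))) \<sigma>) L"
    using hinv_path[OF linear_op_comp[OF Suc.prems(1) linear_op_right_h] Suc.prems(2-4)] by simp
  also have "\<dots> = hinv_dual k (Rh_dual k (\<lambda>V. X (delta (B, S, path_tab V)) \<sigma>)) L"
    using Suc std_rearrange_path by (intro hinv_dual_cong) auto
  finally show ?case by simp
qed simp

lemma left_h_path:
  assumes "linear_op X" "std_path L" "std (B, S, path_tab L)" "k < n"
  shows "X (left_h k (delta (B, S, path_tab L))) \<sigma> =
    Lh_dual k (\<lambda>V. X (delta (B, S, path_tab V)) \<sigma>) L"
  using assms
proof (induction k arbitrary: X)
  case (Suc k)
  have "X (left_h (Suc k) (delta (B, S, path_tab L))) \<sigma> =
      Lh_dual k (\<lambda>V. X (gen_hinv (Suc k) (delta (B, S, path_tab V))) \<sigma>) L"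
    using Suc.IH[OF linear_op_comp[OF Suc.prems(1) linear_op_hinv]] Suc.prems by simp
  also have "\<dots> = Lh_dual k (hinv_dual k (\<lambda>V. X (delta (B, S, path_tab V)) \<sigma>)) L"
    using Suc.prems std_rearrange_path by (intro Lh_dual_cong hinv_path) auto
  finally show ?case by simp
qed simp

lemma jm_Suc_n_path:
  assumes "std_path L" "std (B, S, path_tab L)"
  shows "jm_Suc_n (delta (B, S, path_tab L)) \<sigma> = delta (B, S, path_tab L) \<sigma> -
    (\<alpha> + \<beta>) * \<kappa> * Rh_sum n (\<lambda>i V. left_h i (gen_E (delta (B, S, path_tab V))) \<sigma>) L"
proof -
  have "left_h i (gen_E (right_h i (delta (B, S, path_tab L)))) \<sigma> =
      Rh_dual i (\<lambda>V. left_h i (gen_E (delta (B, S, path_tab V))) \<sigma>) L" if "i < n" for i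
    using right_h_path[OF linear_op_comp[OF linear_op_left_h linear_op_gen(3)] assms that] by simp
  then show ?thesis
    unfolding J_np1_def Rh_sum_def One_nat_def sum.atLeast1_atMost_eq by simp
qed

definition E_scalar :: "box \<Rightarrow> complex" where
  "E_scalar c = (1 + \<theta> * q powi (- HD c)) / (\<kappa> * (\<alpha> + \<beta>))"

lemma gen_E_path_zero:
  assumes "std_path (c # U)" "std (B, S, path_tab (c # U))" "S c \<noteq> 1"
  shows "gen_E (delta (B, S, path_tab (c # U))) = (\<lambda>\<sigma>. 0)"
proof -
  have "path_tab (c # U) (pos S 1) \<noteq> n" if "1 \<in> vals S"
  proof -
    have "pos S 1 \<noteq> c" using pos_vals(1)[OF std_antistandard_S[OF assms(2)] that] assms(3) by metis
    then show ?thesis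
      using path_tab_le[of U "pos S 1"] std_path_length[OF assms(2,1)] by auto
  qed
  then show ?thesis unfolding gen_delta[OF assms(2)] E_basis_def by auto
qed

lemma gen_E_path:
  assumes "std_path (c # U)" "std (B, S, path_tab (c # U))" "S c = 1"
  shows "gen_E (delta (B, S, path_tab (c # U))) = (\<lambda>\<sigma>. \<Sum>b\<in>addable (set U).
    E_scalar c / content_ratio (set U) (HD b) * delta (B, S(c := 0, b := 1), path_tab (b # U)) \<sigma>)"
proof -
  have tail: "young (set U)" "c \<notin> set U" using assms(1) std_path_young addable_notin by auto
  have length_U: "Suc (length U) = n" using std_path_length[OF assms(2,1)] by simp
  have pos: "pos S 1 = c" using pos_eq[OF std_antistandard_S[OF assms(2)] assms(3)] by simp
  have vals: "1 \<in> vals S" using assms(3) in_vals_iff[OF one_neq_zero, of S] by blast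
  have moved: "(path_tab (c # U))(c := 0, b := n) = path_tab (b # U)" for b
  proof -
    have "path_tab U c = 0" using tail(2) unfolding shape_path_tab[of U, symmetric] shape_def by simp
    then show ?thesis using length_U by (auto simp: fun_eq_iff)
  qed
  have shape: "shape (path_tab (c # U)) - {c} = set U" using tail(2) unfolding shape_path_tab by simp
  have last: "path_tab (c # U) c = n" using length_U by simp
  show ?thesis
    unfolding gen_delta[OF assms(2)] E_basis_def prod.case Let_def pos shape moved last
      E_scalar_def[symmetric]
    using vals by (intro ext) (auto simp: content_ratio_addable[OF tail(1)] intro!: sum.cong)
qed

lemma jm_Suc_n_B:
  assumes "std (B, S, W)" "1 \<in> vals B"
  shows "jm_Suc_n (delta (B, S, W)) = delta (B, S, W)"
proof
  fix \<sigma>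
  obtain L where path: "std_path L" "path_tab L = W" using std_path_exists[OF assms(1)] by blast
  have "1 \<notin> vals S" using std_vals_disjoint[OF assms(1)] assms(2) by blast
  then have S_neq_1: "S c \<noteq> 1" for c using in_vals_iff[of 1 S] by blast
  have "left_h i (gen_E (delta (B, S, path_tab V))) \<sigma> = 0"
    if V: "std_path V" "set V = set L" for i V
  proof -
    have std_V: "std (B, S, path_tab V)"
      using std_rearrange_path[OF _ path(1) V] assms(1) path(2) by simp
    obtain c U where "V = c # U" using std_path_length[OF std_V V(1)] n_pos by (cases V) auto
    then show ?thesis
      using gen_E_path_zero[of c U B S] V(1) std_V S_neq_1 linear_op_zero[OF linear_op_left_h]
      by simp
  qed
  then have "Rh_sum n (\<lambda>i V. left_h i (gen_E (delta (B, S, path_tab V))) \<sigma>) L = 0"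
    by (rule Rh_sum_eq_0[OF path(1)])
  then show "jm_Suc_n (delta (B, S, W)) \<sigma> = delta (B, S, W) \<sigma>"
    using jm_Suc_n_path[OF path(1)] assms(1) path(2) by simp
qed

lemma left_h_gen_E_path:
  assumes "std_path V" "std (B, S, path_tab V)" "S c = 1" "c \<in> set V" "i < n"
  shows "left_h i (gen_E (delta (B, S, path_tab V))) \<sigma> =
    (\<Sum>b\<in>addable (set V - {c}). E_scalar c / content_ratio (set V - {c}) (HD b) *
      move_hd c b (Lh_dual i (\<lambda>V. delta (B, S(c := 0, b := 1), path_tab V) \<sigma>)) V)"
proof -
  obtain d U where V_eq: "V = d # U" using assms(4) by (cases V) auto
  show ?thesis
  proof (cases "d = c")
    case True
    have tail: "young (set U)" "set U - {c} = set U"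
      using assms(1) std_path_young addable_notin by (auto simp: V_eq True)
    have "left_h i (delta (B, S(c := 0, b := 1), path_tab (b # U))) \<sigma> =
        Lh_dual i (\<lambda>V. delta (B, S(c := 0, b := 1), path_tab V) \<sigma>) (b # U)"
      if "b \<in> addable (set U)" for b
      using left_h_path[OF linear_op_id, of "b # U"] std_move_box_1[of B S c U b] assms(1-3,5) that
      by (simp add: V_eq True)
    moreover have "left_h i (gen_E (delta (B, S, path_tab V))) = (\<lambda>\<sigma>. \<Sum>b\<in>addable (set U).
        E_scalar c / content_ratio (set U) (HD b) *
        left_h i (delta (B, S(c := 0, b := 1), path_tab (b # U))) \<sigma>)"
      using gen_E_path[of c U B S] assms(1-3)
      unfolding V_eq True
      by (simp only: linear_op_sum[OF linear_op_left_h finite_addable[OF tail(1)]])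
    ultimately show ?thesis by (simp add: V_eq True tail(2))
  next
    case False
    have "S d \<noteq> 1"
      using pos_eq[OF std_antistandard_S[OF assms(2)]] assms(3) False by (metis one_neq_zero)
    then show ?thesis
      using gen_E_path_zero[of d U B S] assms(1,2) False linear_op_zero[OF linear_op_left_h]
      by (simp add: V_eq)
  qed
qed

lemma Rh_sum_gen_E_path:
  assumes L: "std_path L" "std (B, S, path_tab L)" and "S c = 1"
  shows "Rh_sum n (\<lambda>i V. left_h i (gen_E (delta (B, S, path_tab V))) \<sigma>) L =
    E_scalar c * delta (B, S, path_tab L) \<sigma>"
proof -
  define D where "D = set L - {c}"
  define F where "F b = (\<lambda>V. delta (B, S(c := 0, b := 1), path_tab V) \<sigma>)" for b
  have young: "young (set L)" using std_path_young[OF L(1)] .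
  have corner: "c \<in> corners (set L)" using std_corner_1[OF L(2) assms(3)] by (simp add: shape_path_tab)
  have D: "young D" "c \<in> addable D" "set L = insert c D"
    unfolding D_def
    using young_remove_corner[OF corner] addable_remove_corner[OF young corner] corner_in[OF corner]
    by auto
  have "Rh_sum n (\<lambda>i V. left_h i (gen_E (delta (B, S, path_tab V))) \<sigma>) L =
      Rh_sum n (\<lambda>i V. \<Sum>b\<in>addable D.
        E_scalar c / content_ratio D (HD b) * move_hd c b (Lh_dual i (F b)) V) L"
  proof (rule Rh_sum_cong[OF L(1)])
    fix i V assume V: "i < n" "std_path V" "set V = set L"
    show "left_h i (gen_E (delta (B, S, path_tab V))) \<sigma> =
        (\<Sum>b\<in>addable D. E_scalar c / content_ratio D (HD b) * move_hd c b (Lh_dual i (F b)) V)"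
      using left_h_gen_E_path[OF V(2) std_rearrange_path[OF L(2,1) V(2,3)] assms(3) _ V(1)]
        corner_in[OF corner] V(3) by (simp add: D_def F_def)
  qed
  also have "\<dots> = (\<Sum>b\<in>addable D. E_scalar c / content_ratio D (HD b) * rel_trace c b (F b) L)"
    unfolding Rh_sum_sum rel_trace_def std_path_length[OF L(2,1)] ..
  also have "\<dots> = (\<Sum>b\<in>addable D. if c = b then E_scalar c * F c L else 0)"
    using content_ratio_nonzero
      rel_trace_diagonalD[OF std_path_rel_trace_diagonal[OF L(1)] D(3,1,2)]
    by (intro sum.cong refl) auto
  also have "\<dots> = E_scalar c * delta (B, S, path_tab L) \<sigma>"
    using D(2) finite_addable[OF D(1)] assms(3) by (simp add: F_def fun_upd_idem)
  finally show ?thesis .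
qed

lemma jm_Suc_n_S:
  assumes "std (B, S, W)" "1 \<in> vals S"
  shows "jm_Suc_n (delta (B, S, W)) = (\<lambda>\<sigma>. - \<theta> * q powi (- HD (pos S 1)) * delta (B, S, W) \<sigma>)"
proof
  fix \<sigma>
  obtain L where path: "std_path L" "path_tab L = W" using std_path_exists[OF assms(1)] by blast
  have "S (pos S 1) = 1" using pos_vals(1)[OF std_antistandard_S[OF assms(1)] assms(2)] .
  then have "jm_Suc_n (delta (B, S, W)) \<sigma> =
      delta (B, S, W) \<sigma> - (\<alpha> + \<beta>) * \<kappa> * (E_scalar (pos S 1) * delta (B, S, W) \<sigma>)"
    using jm_Suc_n_path[OF path(1)] Rh_sum_gen_E_path[OF path(1)] assms(1) path(2) by simp
  also have "(\<alpha> + \<beta>) * \<kappa> * (E_scalar (pos S 1) * delta (B, S, W) \<sigma>) =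
      (1 + \<theta> * q powi (- HD (pos S 1))) * delta (B, S, W) \<sigma>"
    unfolding E_scalar_def using params_nonzero by simp
  finally show "jm_Suc_n (delta (B, S, W)) \<sigma> = - \<theta> * q powi (- HD (pos S 1)) * delta (B, S, W) \<sigma>"
    by (simp add: algebra_simps)
qed

lemma jm_Suc_n_delta:
  assumes "std \<tau>" "1 \<le> m"
  shows "jm_Suc_n (delta \<tau>) = (\<lambda>\<sigma>. wt \<tau> n * delta \<tau> \<sigma>)"
proof -
  obtain B S W where BSW: "\<tau> = (B, S, W)" by (metis surj_pair)
  note std = assms(1)[unfolded BSW]
  have wt: "wt \<tau> n = (if 1 \<in> vals B then q powi HD (pos B 1) else - \<theta> * q powi (- HD (pos S 1)))"
    using Wt_primed[of 1 B S W] by (simp add: BSW)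
  show ?thesis
  proof (cases "1 \<in> vals B")
    case True
    then have "pos B 1 = (1, 1)"
      using standard_pos_1[OF std_standard_B[OF std]] std_shape_B[OF std] young_lam' by simp
    then show ?thesis using jm_Suc_n_B[OF std True] True unfolding wt by (simp add: BSW HD_def)
  next
    case False
    have "1 \<in> vals B \<union> vals S" unfolding std_vals_BS[OF std] using assms(2) by simp
    then show ?thesis using jm_Suc_n_S[OF std] False unfolding wt by (simp add: BSW)
  qed
qed

lemma Wt_0:
  assumes "std \<tau>"
  shows "wt \<tau> 0 = 1"
proof -
  obtain B S W where BSW: "\<tau> = (B, S, W)" by (metis surj_pair)
  note std = assms[unfolded BSW]
  have "pos W 1 = (1, 1)"
    using standard_pos_1[OF std_standard_W[OF std] std_young[OF std]] std_vals_W[OF std] n_pos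
    by simp
  then show ?thesis using n_pos by (simp add: BSW Wt_unprimed HD_def)
qed

lemma jm_delta:
  assumes "1 \<le> k" "k \<le> m + n" "std \<tau>"
  shows "jm k (delta \<tau>) = (\<lambda>\<sigma>. wt \<tau> (k - 1) * delta \<tau> \<sigma>)"
  using assms
proof (induction k arbitrary: \<tau>)
  case (Suc k)
  consider "k = 0" | "1 \<le> k" "k < n" | "k = n" | j where "k = n + j" "1 \<le> j"
    by (metis One_nat_def Suc_leI le_add_diff_inverse less_imp_le linorder_neqE_nat not_gr_zero
        zero_less_diff)
  then show ?case
  proof cases
    case 1
    then show ?thesis using Wt_0[OF Suc.prems(3)] by simp
  next
    case 2
    then show ?thesis using jm_Suc_less_n[OF 2 Suc.prems(3)] Suc.IH Suc.prems(2) by simp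
  next
    case 3
    then have "jm (Suc k) = jm_Suc_n" using n_pos by simp
    then show ?thesis using jm_Suc_n_delta[OF Suc.prems(3)] Suc.prems(2) 3 by simp
  next
    case (4 j)
    then show ?thesis using jm_Suc_n_plus[of j \<tau>] Suc by simp
  qed
qed simp

end

theorem theorem5p5p9:
  fixes P :: qwb_param and m n :: nat and lam' lam :: "box set"
    and \<tau> :: triple and j :: nat
  assumes "generic_params P" and "eta_zeta_ok P"
    and "1 \<le> m" and "1 \<le> n"
    and "young lam'" and "young lam"
    and "card lam' \<le> m" and "card lam \<le> n" and "m - card lam' = n - card lam"
    and "std_triple m n lam' lam \<tau>"
    and "2 \<le> j" and "j \<le> m + n"
  shows "JM P m n lam' lam j (delta \<tau>) = (\<lambda>\<sigma>. Wt P n \<tau> (j - 1) * delta \<tau> \<sigma>)"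
proof -
  interpret seminormal_rep P m n lam' lam
    using assms(1,2,4-6) by unfold_locales
  show ?thesis using jm_delta[OF _ assms(12,10)] assms(11) by simp
qed

end
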